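(* Let $t\ge 2$ and $r\ge 3$ be integers, let $s\ge 2r-1$ be an odd integer, and let $p=r\big((s-1)t/2+1\big)$. Then $$r\!\left(K_{n,n},K_{p,p},\,p^2-(r-1)st+2\right)=\Omega\!\left(n^{\frac{r}{r-1}\left(1-\frac{1}{s}\right)}\right),$$ where on the left $r(\cdot,\cdot,\cdot)$ denotes the function defined in the context and $r$ inside the arguments and exponent denotes the given integer.
   Context: For graphs $G,H$ and an integer $q$ with $2\le q\le |E(H)|$, an $(H,q)$-coloring of $G$ is an edge-coloring of $G$ in which every subgraph of $G$ isomorphic to $H$ receives at least $q$ distinct colors; $r(G,H,q)$ is the minimum number of colors needed for $G$ to have an $(H,q)$-coloring. $K_{n,n}$, $K_{p,p}$ denote complete bipartite graphs. Asymptotic notation refers to $n\to\infty$ with $r,s,t$ fixed. *)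

theory Defs
  imports Complex_Main "HOL-Library.Landau_Symbols"
begin

type_synonym 'a graph = "'a set \<times> 'a set set"

abbreviation verts :: "'a graph \<Rightarrow> 'a set" where "verts \<equiv> fst"
abbreviation edges :: "'a graph \<Rightarrow> 'a set set" where "edges \<equiv> snd"

definition simple_graph :: "'a graph \<Rightarrow> bool" where
  "simple_graph G \<longleftrightarrow> finite (verts G) \<and> (\<forall>e\<in>edges G. e \<subseteq> verts G \<and> card e = 2)"

text \<open>Subgraphs are not required to be induced.\<close>

definition is_subgraph :: "'a graph \<Rightarrow> 'a graph \<Rightarrow> bool" where
  "is_subgraph S G \<longleftrightarrow> simple_graph S \<and> verts S \<subseteq> verts G \<and> edges S \<subseteq> edges G"

definition graph_iso :: "'a graph \<Rightarrow> 'b graph \<Rightarrow> bool" where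
  "graph_iso S H \<longleftrightarrow> (\<exists>f. bij_betw f (verts S) (verts H) \<and>
     (\<forall>u\<in>verts S. \<forall>v\<in>verts S. {u, v} \<in> edges S \<longleftrightarrow> {f u, f v} \<in> edges H))"

definition complete_bipartite :: "nat \<Rightarrow> nat \<Rightarrow> (nat + nat) graph" where
  "complete_bipartite m n =
     (Inl ` {..<m} \<union> Inr ` {..<n}, {{Inl i, Inr j} | i j. i < m \<and> j < n})"

definition Hq_coloring :: "'a graph \<Rightarrow> 'b graph \<Rightarrow> nat \<Rightarrow> ('a set \<Rightarrow> nat) \<Rightarrow> bool" where
  "Hq_coloring G H q c \<longleftrightarrow>
     (\<forall>S. is_subgraph S G \<and> graph_iso S H \<longrightarrow> q \<le> card (c ` edges S))"

text \<open>
  For a finite simple graph \<open>G\<close> and \<open>q \<le> card (edges H)\<close> the minimum is attained,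
  since giving all edges of \<open>G\<close> distinct colors is an \<open>(H,q)\<close>-coloring.
\<close>

definition gen_ramsey :: "'a graph \<Rightarrow> 'b graph \<Rightarrow> nat \<Rightarrow> nat" where
  "gen_ramsey G H q = (LEAST k. \<exists>c. Hq_coloring G H q c \<and> c ` edges G \<subseteq> {..<k})"

lemma simple_graph_complete_bipartite: "simple_graph (complete_bipartite m n)"
  by (auto simp: simple_graph_def complete_bipartite_def)

lemma card_edges_complete_bipartite: "card (edges (complete_bipartite m n)) = m * n"
proof -
  have "edges (complete_bipartite m n) = (\<lambda>(i, j). {Inl i, Inr j}) ` ({..<m} \<times> {..<n})"
    by (auto simp: complete_bipartite_def)
  moreover have "inj_on (\<lambda>(i, j). {Inl i, Inr j}) ({..<m} \<times> {..<n})"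
    by (auto simp: inj_on_def doubleton_eq_iff)
  ultimately show ?thesis
    by (simp add: card_image card_cartesian_product)
qed

text \<open>
  With the parameters of the theorem, the natural-number subtraction in \<open>q\<close> does not
  truncate, and \<open>2 \<le> q \<le> p\<^sup>2\<close>, the number of edges of \<open>K\<^sub>p\<^sub>,\<^sub>p\<close>.
\<close>

lemma parameter_range:
  fixes r s t p :: nat
  assumes "t \<ge> 2" "r \<ge> 3" "s \<ge> 2 * r - 1" "odd s" and p: "p = r * ((s - 1) * t div 2 + 1)"
  shows "(r - 1) * s * t \<le> p\<^sup>2" "p\<^sup>2 - (r - 1) * s * t + 2 \<le> p\<^sup>2"
proof -
  obtain m where s: "s = 2 * m + 1" using \<open>odd s\<close> by (elim oddE)
  have m: "m \<ge> 2" using assms s by simp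
  have p': "p = r * (m * t + 1)" using p s by (simp add: algebra_simps)
  have "m * t \<ge> 1" using m assms by (simp add: Suc_le_eq)
  have 1: "s * t \<le> 3 * (m * t)" using s m by (simp add: algebra_simps)
  have 2: "(m * t) * 3 \<le> (m * t + 1)\<^sup>2 * r"
    using \<open>r \<ge> 3\<close> by (intro mult_mono) (auto simp: power2_eq_square algebra_simps)
  have "(r - 1) * s * t \<le> r * (s * t)" by (simp add: mult.assoc)
  also have "\<dots> \<le> r * ((m * t + 1)\<^sup>2 * r)"
    using 1 2 by (intro mult_le_mono2) linarith
  also have "\<dots> = p\<^sup>2" unfolding p' by (simp add: power2_eq_square algebra_simps)
  finally show *: "(r - 1) * s * t \<le> p\<^sup>2" .
  have "2 * 1 * 1 \<le> (r - 1) * s * t"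
    using assms by (intro mult_mono) auto
  then show "p\<^sup>2 - (r - 1) * s * t + 2 \<le> p\<^sup>2" using * by linarith
qed

end

(* Call the number of edges minus the number of colours of a subgraph its saving. The colouring
   condition bounds the saving of every subgraph with p vertices on either side by
   (r - 1)st - 2. This first forces all monochromatic stars to have fewer than p leaves.
   Next consider the energy graph on r-tuples of vertices, in which two tuples are adjacent if
   the r edges between corresponding entries have a common colour. If there are fewer than
   eps * n^(r/(r-1) (1-1/s)) colours, then counting gives it so many edges that, after passing
   to a subgraph of large minimum degree, some two tuples are joined by arbitrarily many walks
   of length s. Since stars are small, few walks meet a given bounded set in each of their
   tuples, so there is always a walk that leaves the part built so far.
   Projecting t of these walks to K_{n,n} gives a subgraph that plays the role of r disjoint
   theta graphs; overlaps between walks only increase the saving per vertex. Filling it up to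
   p vertices on either side with neighbouring tuples yields a saving of at least
   (r - 1)st - 1. *)

theory Submission
  imports Defs "HOL-Library.FuncSet"
begin

section \<open>Counting lists\<close>

text \<open>The parameters fit \<open>r\<close> disjoint theta graphs, each made of \<open>t\<close>
  paths of length \<open>s = 2h + 1\<close>, with parallel edges coloured alike. They have
  \<open>p = r(ht + 1)\<close> vertices on either side and save at least
  \<open>S = (r - 1)st\<close> colours, while the colouring condition allows only
  \<open>S - 2\<close>. The slack of 2 pays for padding, which costs less than 1 per side. Since
  \<open>s\<close> is odd, the end tuples lie on opposite sides and both sides grow alike. The
  exponent comes from the energy graph: it has about \<open>n^r\<close> vertices and, for
  \<open>C\<close> colours, edges of order at least \<open>n^(2r) / C^(r-1)\<close>. Its average
  degree must exceed a multiple of \<open>d = n^(r/s)\<close>, because then the walks of length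
  \<open>s\<close> outnumber their \<open>n^r = d^s\<close> possible endpoints. The obstacle is that
  the walks found may overlap: counting guarantees only one fresh tuple on each. The potential, a
  saving corrected by the number of vertices, makes the overlaps harmless. Small stars are not
  immediate either: one star with \<open>p\<close> leaves saves just \<open>p - 1\<close>, which is
  at most \<open>S - 2\<close>, so it has to be combined with a second structure.\<close>

text \<open>Prepending is injective, so the numbers of admissible heads multiply. \<open>G\<close>
  judges the whole list built so far, which lets a new entry depend on all earlier ones.\<close>

lemma card_lists_ge_power:
  assumes "finite V" "G []"
    and ext: "\<And>zs. \<lbrakk>G zs; set zs \<subseteq> V; length zs < k\<rbrakk> \<Longrightarrow> D \<le> card {z \<in> V. G (z # zs)}"
  shows "D ^ k \<le> card {zs. set zs \<subseteq> V \<and> length zs = k \<and> G zs}"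
  using ext
proof (induction k)
  case 0
  have "{zs. set zs \<subseteq> V \<and> length zs = 0 \<and> G zs} = {[]}" using \<open>G []\<close> by auto
  then show ?case by simp
next
  case (Suc k)
  let ?P = "\<lambda>k. {zs. set zs \<subseteq> V \<and> length zs = k \<and> G zs}"
  let ?S = "SIGMA zs:?P k. {z \<in> V. G (z # zs)}"
  have fin: "finite (?P j)" for j
    by (rule finite_subset[OF _ finite_lists_length_eq[OF \<open>finite V\<close>, of j]]) auto
  have "D ^ Suc k \<le> card (?P k) * D"
    using Suc by simp
  also have "\<dots> = (\<Sum>zs\<in>?P k. D)" by simp
  also have "\<dots> \<le> (\<Sum>zs\<in>?P k. card {z \<in> V. G (z # zs)})"
    by (rule sum_mono) (use Suc.prems in auto)
  also have "\<dots> = card ?S"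
    using fin \<open>finite V\<close> by (subst card_SigmaI) auto
  also have "\<dots> = card ((\<lambda>(zs, z). z # zs) ` ?S)"
    by (rule card_image[symmetric]) (auto simp: inj_on_def)
  also have "\<dots> \<le> card (?P (Suc k))"
    by (rule card_mono[OF fin]) auto
  finally show ?case .
qed

text \<open>By \<open>tl\<close>, every counted list arises by extending a counted list, so the
  pairs of tail and head cover everything.\<close>

lemma card_lists_le_power:
  assumes "finite V"
    and tl: "\<And>z zs. G (z # zs) \<Longrightarrow> G zs"
    and ext: "\<And>zs. \<lbrakk>G zs; set zs \<subseteq> V\<rbrakk> \<Longrightarrow> card {z \<in> V. G (z # zs)} \<le> D"
  shows "card {zs. set zs \<subseteq> V \<and> length zs = k \<and> G zs} \<le> D ^ k"
proof (induction k)
  case 0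
  have "{zs. set zs \<subseteq> V \<and> length zs = 0 \<and> G zs} \<subseteq> {[]}" by auto
  from card_mono[OF _ this] show ?case by simp
next
  case (Suc k)
  let ?P = "\<lambda>k. {zs. set zs \<subseteq> V \<and> length zs = k \<and> G zs}"
  let ?S = "SIGMA zs:?P k. {z \<in> V. G (z # zs)}"
  have fin: "finite (?P j)" for j
    by (rule finite_subset[OF _ finite_lists_length_eq[OF \<open>finite V\<close>, of j]]) auto
  have finS: "finite ?S" using fin \<open>finite V\<close> by (intro finite_SigmaI) auto
  have "?P (Suc k) \<subseteq> (\<lambda>(zs, z). z # zs) ` ?S"
  proof
    fix xs assume xs: "xs \<in> ?P (Suc k)"
    then obtain z zs where "xs = z # zs" by (cases xs) auto
    with xs tl show "xs \<in> (\<lambda>(zs, z). z # zs) ` ?S"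
      by (intro image_eqI[of _ _ "(zs, z)"]) auto
  qed
  then have "card (?P (Suc k)) \<le> card ((\<lambda>(zs, z). z # zs) ` ?S)"
    using finS by (intro card_mono) auto
  also have "\<dots> \<le> card ?S" by (rule card_image_le[OF finS])
  also have "\<dots> = (\<Sum>zs\<in>?P k. card {z \<in> V. G (z # zs)})"
    using fin \<open>finite V\<close> by (subst card_SigmaI) auto
  also have "\<dots> \<le> (\<Sum>zs\<in>?P k. D)"
    by (rule sum_mono) (use ext in auto)
  also have "\<dots> \<le> D ^ Suc k" using Suc by simp
  finally show ?case .
qed

lemma card_lists_nth_le:
  assumes "\<And>i. i < r \<Longrightarrow> finite (S i) \<and> card (S i) \<le> b"
  shows "finite {v. length v = r \<and> (\<forall>i<r. v ! i \<in> S i)}"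
    and "card {v. length v = r \<and> (\<forall>i<r. v ! i \<in> S i)} \<le> b ^ r"
proof -
  let ?P = "PiE {..<r} S"
  have fin: "finite ?P" by (rule finite_PiE) (use assms in auto)
  have sub: "{v. length v = r \<and> (\<forall>i<r. v ! i \<in> S i)} \<subseteq> (\<lambda>f. map f [0..<r]) ` ?P"
  proof
    fix v assume v: "v \<in> {v. length v = r \<and> (\<forall>i<r. v ! i \<in> S i)}"
    have "v = map (restrict ((!) v) {..<r}) [0..<r]"
      by (rule nth_equalityI) (use v in auto)
    moreover have "restrict ((!) v) {..<r} \<in> ?P" using v by auto
    ultimately show "v \<in> (\<lambda>f. map f [0..<r]) ` ?P" by blast
  qed
  then show "finite {v. length v = r \<and> (\<forall>i<r. v ! i \<in> S i)}"
    using fin finite_surj by blast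
  have "card {v. length v = r \<and> (\<forall>i<r. v ! i \<in> S i)} \<le> card ?P"
    using card_mono[OF finite_imageI[OF fin] sub] card_image_le[OF fin] le_trans by blast
  also have "\<dots> = (\<Prod>i<r. card (S i))" by (simp add: card_PiE)
  also have "\<dots> \<le> (\<Prod>i<r. b)" by (rule prod_mono) (use assms in auto)
  finally show "card {v. length v = r \<and> (\<forall>i<r. v ! i \<in> S i)} \<le> b ^ r" by simp
qed

lemma sorted_wrt_neq_distinct: "sorted_wrt (\<lambda>e' e. \<not> e = e') es \<Longrightarrow> distinct es"
  by (induction es) auto

lemma sum_card_swap:
  assumes "finite A" "finite B"
  shows "(\<Sum>a\<in>A. card {b \<in> B. P a b}) = (\<Sum>b\<in>B. card {a \<in> A. P a b})"
proof -
  have "(\<Sum>a\<in>A. card {b \<in> B. P a b}) = (\<Sum>a\<in>A. \<Sum>b\<in>B. if P a b then 1 else 0)"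
    using assms by (simp only: card_eq_sum sum.inter_filter)
  also have "\<dots> = (\<Sum>b\<in>B. \<Sum>a\<in>A. if P a b then 1 else 0)" by (rule sum.swap)
  also have "\<dots> = (\<Sum>b\<in>B. card {a \<in> A. P a b})"
    using assms by (simp only: card_eq_sum sum.inter_filter)
  finally show ?thesis .
qed

text \<open>A power-mean estimate for the \<open>r\<close>-th moment of the class sizes: discarding the classes
  of at most half the average size avoids Jensen's inequality.\<close>

lemma moment_lower_bound:
  fixes D :: "nat \<Rightarrow> 'b set" and C b r :: nat
  assumes fin: "\<And>\<chi>. \<chi> < C \<Longrightarrow> finite (D \<chi>)"
    and bad: "\<And>\<chi> e. \<lbrakk>\<chi> < C; e \<in> D \<chi>\<rbrakk> \<Longrightarrow> card {e' \<in> D \<chi>. bad e e'} \<le> b"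
    and "r \<ge> 1" "C \<ge> 1"
    and W: "0 \<le> W" "W \<le> real (\<Sum>\<chi><C. card (D \<chi>))" and large: "4 * real b * real r * real C \<le> W"
  shows "W / 4 * (W / (4 * real C)) ^ (r - 1)
     \<le> real (\<Sum>\<chi><C. card {es. set es \<subseteq> D \<chi> \<and> length es = r \<and> sorted_wrt (\<lambda>e' e. \<not> bad e e') es})"
proof -
  let ?N = "\<lambda>\<chi>. card {es. set es \<subseteq> D \<chi> \<and> length es = r \<and> sorted_wrt (\<lambda>e' e. \<not> bad e e') es}"
  let ?h = "W / (2 * real C)"
  \<comment> \<open>Greedy choice: each of the fewer than \<open>r\<close> entries chosen so far
    blocks at most \<open>b\<close> candidates.\<close>
  have N: "(card (D \<chi>) - b * r) ^ r \<le> ?N \<chi>" if \<chi>: "\<chi> < C" for \<chi>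
  proof (rule card_lists_ge_power[OF fin[OF \<chi>]])
    fix zs assume zs: "set zs \<subseteq> D \<chi>" "length zs < r" "sorted_wrt (\<lambda>e' e. \<not> bad e e') zs"
    let ?U = "\<Union>e\<in>set zs. {e' \<in> D \<chi>. bad e e'}"
    have "card ?U \<le> (\<Sum>e\<in>set zs. card {e' \<in> D \<chi>. bad e e'})" by (rule card_UN_le) simp
    also have "\<dots> \<le> (\<Sum>e\<in>set zs. b)" using zs bad[OF \<chi>] by (intro sum_mono) auto
    also have "\<dots> \<le> b * r"
    proof -
      have "card (set zs) \<le> r" using zs card_length[of zs] by linarith
      then show ?thesis by simp
    qed
    finally have U: "card ?U \<le> b * r" .
    have "card (D \<chi>) - b * r \<le> card (D \<chi>) - card ?U" using U by simp
    also have "\<dots> \<le> card (D \<chi> - ?U)"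
      by (rule diff_card_le_card_Diff) (use fin[OF \<chi>] in auto)
    also have "\<dots> \<le> card {z \<in> D \<chi>. sorted_wrt (\<lambda>e' e. \<not> bad e e') (z # zs)}"
      by (rule card_mono) (use fin[OF \<chi>] zs in auto)
    finally show "card (D \<chi>) - b * r \<le> \<dots>" .
  qed simp
  define G where "G = {\<chi>\<in>{..<C}. ?h \<le> real (card (D \<chi>))}"
  \<comment> \<open>One factor keeps \<open>card (D \<chi>)\<close>, so that summing over
    \<open>G\<close> recovers at least half of \<open>W\<close>; the other \<open>r - 1\<close>
    factors are bounded uniformly. By \<open>large\<close>, \<open>b * r\<close> is at most half of
    any class in \<open>G\<close>.\<close>
  have G: "real (card (D \<chi>)) / 2 * (?h / 2) ^ (r - 1) \<le> real (?N \<chi>)" if "\<chi> \<in> G" for \<chi>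
  proof -
    have \<chi>: "\<chi> < C" and h: "?h \<le> real (card (D \<chi>))" using that by (auto simp: G_def)
    have "2 * real (b * r) \<le> ?h" using large \<open>C \<ge> 1\<close> by (simp add: field_simps)
    then have "real (card (D \<chi>)) / 2 \<le> real (card (D \<chi>) - b * r)" using h by linarith
    moreover have "?h / 2 \<le> real (card (D \<chi>)) / 2" using h by simp
    ultimately have "real (card (D \<chi>)) / 2 * (?h / 2) ^ (r - 1)
        \<le> real (card (D \<chi>) - b * r) * real (card (D \<chi>) - b * r) ^ (r - 1)"
      using W(1) by (intro mult_mono power_mono) auto
    also have "\<dots> = real ((card (D \<chi>) - b * r) ^ r)"
      using \<open>r \<ge> 1\<close> by (cases r) simp_all
    also have "\<dots> \<le> real (?N \<chi>)" using N[OF \<chi>] by (simp only: of_nat_le_iff)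
    finally show ?thesis .
  qed
  have "(\<Sum>\<chi>\<in>{..<C} - G. real (card (D \<chi>))) \<le> (\<Sum>\<chi>\<in>{..<C} - G. ?h)"
    by (rule sum_mono) (auto simp: G_def)
  also have "\<dots> \<le> (\<Sum>\<chi><C. ?h)" using W(1) by (intro sum_mono2) auto
  also have "\<dots> = W / 2" using \<open>C \<ge> 1\<close> by simp
  finally have "(\<Sum>\<chi>\<in>{..<C} - G. real (card (D \<chi>))) \<le> W / 2" .
  moreover have "(\<Sum>\<chi><C. real (card (D \<chi>)))
      = (\<Sum>\<chi>\<in>{..<C} - G. real (card (D \<chi>))) + (\<Sum>\<chi>\<in>G. real (card (D \<chi>)))"
    by (rule sum.subset_diff) (auto simp: G_def)
  ultimately have half: "W / 2 \<le> (\<Sum>\<chi>\<in>G. real (card (D \<chi>)))" using W(2) by simp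
  have "W / 4 * (W / (4 * real C)) ^ (r - 1) = W / 2 / 2 * (?h / 2) ^ (r - 1)" by simp
  also have "\<dots> \<le> (\<Sum>\<chi>\<in>G. real (card (D \<chi>))) / 2 * (?h / 2) ^ (r - 1)"
    using half W(1) by (intro mult_right_mono) auto
  also have "\<dots> = (\<Sum>\<chi>\<in>G. real (card (D \<chi>)) / 2 * (?h / 2) ^ (r - 1))"
    by (simp add: sum_distrib_right sum_divide_distrib)
  also have "\<dots> \<le> (\<Sum>\<chi>\<in>G. real (?N \<chi>))" by (rule sum_mono) (rule G)
  also have "\<dots> \<le> (\<Sum>\<chi><C. real (?N \<chi>))" by (rule sum_mono2) (auto simp: G_def)
  finally show ?thesis by simp
qed

text \<open>Deleting a vertex of degree below \<open>d\<close> destroys fewer than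
  \<open>2 * d\<close> ordered pairs, so the edge bound survives the deletion. It fails for the
  empty set, so the deletions stop before that.\<close>

lemma min_degree_subset:
  assumes "finite V" and sym: "\<And>u v. A u v \<Longrightarrow> A v u"
    and "2 * d * card V < card {(u, v) \<in> V \<times> V. A u v}"
  shows "\<exists>U\<subseteq>V. U \<noteq> {} \<and> (\<forall>u\<in>U. d \<le> card {v \<in> U. A u v})"
  using assms(1,3)
proof (induction "card V" arbitrary: V)
  case 0
  then show ?case by simp
next
  case (Suc k)
  show ?case
  proof (cases "\<forall>u\<in>V. d \<le> card {v \<in> V. A u v}")
    case True
    moreover have "V \<noteq> {}" using Suc by auto
    ultimately show ?thesis by blast
  next
    case False
    then obtain u where u: "u \<in> V" "card {v \<in> V. A u v} < d" by force
    let ?N = "{v \<in> V. A u v}"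
    let ?E = "\<lambda>V. {(u, v) \<in> V \<times> V. A u v}"
    have fin: "finite ?N" "finite (?E (V - {u}))"
      using Suc.prems(1) by (auto intro: finite_subset[of _ "V \<times> V"])
    have "?E V \<subseteq> ?E (V - {u}) \<union> (Pair u ` ?N \<union> (\<lambda>v. (v, u)) ` ?N)"
      using sym by auto
    then have "card (?E V) \<le> card (?E (V - {u}) \<union> (Pair u ` ?N \<union> (\<lambda>v. (v, u)) ` ?N))"
      using fin by (intro card_mono) auto
    also have "\<dots> \<le> card (?E (V - {u})) + (card (Pair u ` ?N) + card ((\<lambda>v. (v, u)) ` ?N))"
      by (meson add_left_mono card_Un_le le_trans)
    also have "\<dots> \<le> card (?E (V - {u})) + (card ?N + card ?N)"
      by (intro add_mono card_image_le fin order_refl)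
    finally have *: "card (?E V) \<le> card (?E (V - {u})) + 2 * card ?N" by simp
    have k: "k = card (V - {u})" using Suc u by simp
    have "card V = Suc k" using Suc by simp
    then have "2 * d * card (V - {u}) < card (?E (V - {u}))"
      using * u(2) Suc.prems(2) k by (simp add: algebra_simps)
    from Suc.hyps(1)[OF k _ this] Suc.prems(1) show ?thesis by auto
  qed
qed

section \<open>A potential for coloured subgraphs\<close>

text \<open>Joining \<open>r\<close> new vertices to the graph by \<open>r\<close> equally coloured new edges leaves the
  potential unchanged.\<close>

definition potential :: "nat \<Rightarrow> ('a set \<Rightarrow> nat) \<Rightarrow> 'a set \<Rightarrow> 'a set set \<Rightarrow> int" where
  "potential r c A F =
     int r * (int (card F) - int (card (c ` F))) - (int r - 1) * int (card A)"

text \<open>Charge each new vertex to the edge leaving it. The edge entering the first new vertex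
  stays uncharged; if no vertex is new, the assumed new edge does.\<close>

lemma path_new_edges_gt_new_vertices:
  fixes v :: "nat \<Rightarrow> 'a"
  assumes "v 0 \<in> A" "v s \<in> A" "\<Union>F \<subseteq> A" "\<exists>k<s. {v k, v (Suc k)} \<notin> F"
  shows "card {k. k \<le> s \<and> v k \<notin> A} < card {k. k < s \<and> {v k, v (Suc k)} \<notin> F}"
proof (rule psubset_card_mono)
  let ?J = "{k. k \<le> s \<and> v k \<notin> A}" and ?I = "{k. k < s \<and> {v k, v (Suc k)} \<notin> F}"
  have sub: "?J \<subseteq> ?I"
  proof
    fix k assume k: "k \<in> ?J"
    then have "k < s" using assms(2) by (cases "k = s") auto
    then show "k \<in> ?I" using k assms(3) by auto
  qed
  have "?J \<noteq> ?I"
  proof (cases "?J = {}")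
    case True
    then show ?thesis using assms(4) by blast
  next
    case False
    define m where "m = Min ?J"
    have m: "m \<in> ?J" "\<And>k. k \<in> ?J \<Longrightarrow> m \<le> k"
      using False Min_in[of ?J] Min_le[of ?J] by (auto simp: m_def simp del: Min_in)
    then obtain l where l: "m = Suc l" using assms(1) by (cases m) auto
    have "l \<notin> ?J" using m(2)[of l] l by auto
    moreover have "l \<in> ?I" using m(1) l assms(3) by auto
    ultimately show ?thesis by blast
  qed
  with sub show "?J \<subset> ?I" by blast
qed simp

text \<open>Adding \<open>r\<close> parallel paths whose \<open>k\<close>-th edges share a colour. A step creates a new colour
  only if all its \<open>r\<close> edges are new, whereas each path gains more edges than vertices; so
  overlaps with the old graph never lower the gain below that of \<open>r\<close> disjoint paths.\<close>

lemma potential_add_paths: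
  fixes v :: "nat \<Rightarrow> nat \<Rightarrow> 'a"
  assumes "finite A" "finite F" "\<Union>F \<subseteq> A"
    and inj: "\<And>k j k' j'. \<lbrakk>k \<le> s; j < r; k' \<le> s; j' < r; v k j = v k' j'\<rbrakk> \<Longrightarrow> k = k' \<and> j = j'"
    and col: "\<And>k j. \<lbrakk>k < s; j < r\<rbrakk> \<Longrightarrow> c {v k j, v (Suc k) j} = \<chi> k"
    and ends: "\<And>j. j < r \<Longrightarrow> v 0 j \<in> A \<and> v s j \<in> A"
    and new: "\<And>j. j < r \<Longrightarrow> \<exists>k<s. {v k j, v (Suc k) j} \<notin> F"
    and "r \<ge> 1"
  shows "potential r c A F + int r * (int r - 1) \<le>
    potential r c (A \<union> (\<lambda>(k, j). v k j) ` ({..s} \<times> {..<r}))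
      (F \<union> (\<lambda>(k, j). {v k j, v (Suc k) j}) ` ({..<s} \<times> {..<r}))"
    (is "_ \<le> potential r c ?A' ?F'")
proof -
  let ?J = "\<lambda>j. {k. k \<le> s \<and> v k j \<notin> A}"
  let ?I = "\<lambda>j. {k. k < s \<and> {v k j, v (Suc k) j} \<notin> F}"
  let ?T = "{k. k < s \<and> (\<forall>j<r. {v k j, v (Suc k) j} \<notin> F)}"
  have lt: "card (?J j) + 1 \<le> card (?I j)" if "j < r" for j
    using path_new_edges_gt_new_vertices[of "\<lambda>k. v k j" A s F] ends[OF that] new[OF that] assms(3)
    by simp
  have T: "card ?T \<le> card (?I j)" if "j < r" for j
    using that by (intro card_mono) auto

  have "?A' \<subseteq> A \<union> (\<lambda>(j, k). v k j) ` (SIGMA j:{..<r}. ?J j)" by force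
  then have "card ?A' \<le> card (A \<union> (\<lambda>(j, k). v k j) ` (SIGMA j:{..<r}. ?J j))"
    using assms(1) by (intro card_mono) auto
  also have "\<dots> \<le> card A + card ((\<lambda>(j, k). v k j) ` (SIGMA j:{..<r}. ?J j))"
    by (rule card_Un_le)
  also have "\<dots> \<le> card A + card (SIGMA j:{..<r}. ?J j)"
    by (intro add_left_mono card_image_le) auto
  also have "\<dots> = card A + (\<Sum>j<r. card (?J j))" by simp
  finally have A': "card ?A' \<le> card A + (\<Sum>j<r. card (?J j))" .

  let ?ed = "\<lambda>(j, k). {v k j, v (Suc k) j}"
  have "inj_on ?ed (SIGMA j:{..<r}. ?I j)"
  proof (rule inj_onI, clarify)
    fix j k j' k'
    assume *: "j < r" "k < s" "j' < r" "k' < s"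
      "{v k j, v (Suc k) j} = {v k' j', v (Suc k') j'}"
    then consider "v k j = v k' j'" | "v k j = v (Suc k') j'" "v (Suc k) j = v k' j'"
      by (auto simp: doubleton_eq_iff)
    then show "j = j' \<and> k = k'"
    proof cases
      case 1
      then show ?thesis using inj[of k j k' j'] * by auto
    next
      \<comment> \<open>The edges would be traversed in opposite directions, which forces both
        \<open>k = Suc k'\<close> and \<open>Suc k = k'\<close>.\<close>
      case 2
      then show ?thesis using inj[of k j "Suc k'" j'] inj[of "Suc k" j k' j'] * by auto
    qed
  qed
  then have "(\<Sum>j<r. card (?I j)) = card (?ed ` (SIGMA j:{..<r}. ?I j))"
    by (simp add: card_image)
  then have "card F + (\<Sum>j<r. card (?I j)) = card (F \<union> ?ed ` (SIGMA j:{..<r}. ?I j))"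
    using assms(2) by (subst card_Un_disjoint) auto
  also have "\<dots> \<le> card ?F'" using assms(2) by (intro card_mono) auto
  finally have F': "card F + (\<Sum>j<r. card (?I j)) \<le> card ?F'" .

  have "c ` ?F' \<subseteq> c ` F \<union> \<chi> ` ?T"
  proof (intro image_subsetI)
    fix e assume "e \<in> ?F'"
    then consider "e \<in> F" | k j where "k < s" "j < r" "e = {v k j, v (Suc k) j}" by auto
    then show "c e \<in> c ` F \<union> \<chi> ` ?T"
    proof cases
      case 2
      show ?thesis
      proof (cases "k \<in> ?T")
        case True
        then show ?thesis using 2 col by auto
      next
        case False
        then obtain i where i: "i < r" "{v k i, v (Suc k) i} \<in> F" using 2 by auto
        then have "c e = c {v k i, v (Suc k) i}" using 2 col by auto
        then show ?thesis using i by blast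
      qed
    qed auto
  qed
  then have "card (c ` ?F') \<le> card (c ` F \<union> \<chi> ` ?T)"
    using assms(2) by (intro card_mono) auto
  also have "\<dots> \<le> card (c ` F) + card (\<chi> ` ?T)" by (rule card_Un_le)
  also have "\<dots> \<le> card (c ` F) + card ?T" by (intro add_left_mono card_image_le) auto
  finally have c': "card (c ` ?F') \<le> card (c ` F) + card ?T" .

  \<comment> \<open>The loss \<open>r * card ?T\<close> is shared out evenly among the
    \<open>r\<close> paths. As \<open>card (?I j)\<close> is at least \<open>card (?J j) + 1\<close>
    and at least \<open>card ?T\<close>, each path contributes \<open>r - 1\<close> or more.\<close>
  have "(\<Sum>j<r. int r - 1)
      \<le> (\<Sum>j<r. int r * int (card (?I j)) - int (card ?T) - (int r - 1) * int (card (?J j)))"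
  proof (rule sum_mono)
    fix j assume "j \<in> {..<r}"
    then have *: "int (card (?J j)) + 1 \<le> int (card (?I j))" "int (card ?T) \<le> int (card (?I j))"
      using lt[of j] T[of j] by auto
    have "(int r - 1) * int (card (?J j)) \<le> (int r - 1) * (int (card (?I j)) - 1)"
      using *(1) \<open>r \<ge> 1\<close> by (intro mult_left_mono) auto
    with *(2) show "int r - 1
        \<le> int r * int (card (?I j)) - int (card ?T) - (int r - 1) * int (card (?J j))"
      by (simp add: algebra_simps)
  qed
  then have main: "int r * (int r - 1) \<le> int r * (\<Sum>j<r. int (card (?I j)))
      - int r * int (card ?T) - (int r - 1) * (\<Sum>j<r. int (card (?J j)))"
    by (simp add: sum_subtractf sum_distrib_left)
  have "int r * (int (card F) + (\<Sum>j<r. int (card (?I j)))) \<le> int r * int (card ?F')"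
    using F' by (intro mult_left_mono) (simp_all flip: of_nat_sum of_nat_add)
  moreover have "int r * int (card (c ` ?F')) \<le> int r * (int (card (c ` F)) + int (card ?T))"
    using c' by (intro mult_left_mono) simp_all
  moreover have "(int r - 1) * int (card ?A')
      \<le> (int r - 1) * (int (card A) + (\<Sum>j<r. int (card (?J j))))"
    using A' \<open>r \<ge> 1\<close> by (intro mult_left_mono) (simp_all flip: of_nat_sum of_nat_add)
  ultimately show ?thesis
    using main unfolding potential_def by (simp only: algebra_simps)
qed

text \<open>There is at most one new colour, so the change is at least
  \<open>r * (\<rho> - 1) - (r - 1) * \<rho> = \<rho> - r\<close>. A full tuple is free;
  \<open>\<rho> < r\<close> occurs when a side has no room left for a full one.\<close>

lemma potential_add_parallel_edges:
  assumes "finite A" "finite F" "\<Union>F \<subseteq> A" "inj_on y {..<\<rho>}" "y ` {..<\<rho>} \<inter> A = {}"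
    and x: "\<And>j. j < \<rho> \<Longrightarrow> x j \<in> A" and col: "\<And>j. j < \<rho> \<Longrightarrow> c {x j, y j} = \<chi>"
  shows "potential r c A F + int \<rho> - int r
    \<le> potential r c (A \<union> y ` {..<\<rho>}) (F \<union> (\<lambda>j. {x j, y j}) ` {..<\<rho>})"
proof -
  have A: "card (A \<union> y ` {..<\<rho>}) = card A + \<rho>"
    using assms(1,4,5) by (subst card_Un_disjoint) (auto simp: card_image)
  have inj: "inj_on (\<lambda>j. {x j, y j}) {..<\<rho>}"
  proof (rule inj_onI)
    fix i j assume ij: "i \<in> {..<\<rho>}" "j \<in> {..<\<rho>}" "{x i, y i} = {x j, y j}"
    then have "y i \<noteq> x j" using x[of j] assms(5) by auto
    then have "y i = y j" using ij(3) by (auto simp: doubleton_eq_iff)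
    then show "i = j" using ij assms(4) by (auto dest: inj_onD)
  qed
  have "F \<inter> (\<lambda>j. {x j, y j}) ` {..<\<rho>} = {}" using assms(3,5) by blast
  then have F: "card (F \<union> (\<lambda>j. {x j, y j}) ` {..<\<rho>}) = card F + \<rho>"
    using assms(2) inj by (subst card_Un_disjoint) (auto simp: card_image)
  have "c ` (F \<union> (\<lambda>j. {x j, y j}) ` {..<\<rho>}) \<subseteq> insert \<chi> (c ` F)" using col by auto
  then have "card (c ` (F \<union> (\<lambda>j. {x j, y j}) ` {..<\<rho>})) \<le> card (insert \<chi> (c ` F))"
    using assms(2) by (intro card_mono) auto
  also have "\<dots> \<le> card (c ` F) + 1" using assms(2) by (simp add: card_insert_if)
  finally have "int r * int (card (c ` (F \<union> (\<lambda>j. {x j, y j}) ` {..<\<rho>})))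
      \<le> int r * (int (card (c ` F)) + 1)" by (intro mult_left_mono) auto
  then show ?thesis unfolding potential_def A F by (simp add: algebra_simps)
qed

section \<open>Colourings of complete bipartite graphs with few colours\<close>

definition cross :: "'a set \<Rightarrow> 'a set \<Rightarrow> 'a set set" where
  "cross L R = {{u, v} | u v. u \<in> L \<and> v \<in> R}"

lemma cross_commute: "cross L R = cross R L"
  unfolding cross_def by (auto simp: insert_commute)

lemma crossI: "u \<in> L \<Longrightarrow> v \<in> R \<Longrightarrow> {u, v} \<in> cross L R"
  unfolding cross_def by blast

lemma crossI': "u \<in> R \<Longrightarrow> v \<in> L \<Longrightarrow> {u, v} \<in> cross L R"
  unfolding cross_def by (auto simp: insert_commute)

lemma cross_doubleton_iff: "{u, v} \<in> cross L R \<longleftrightarrow> u \<in> L \<and> v \<in> R \<or> u \<in> R \<and> v \<in> L"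
  unfolding cross_def by (auto simp: doubleton_eq_iff)

lemma cross_mono: "A \<subseteq> L \<Longrightarrow> B \<subseteq> R \<Longrightarrow> cross A B \<subseteq> cross L R"
  unfolding cross_def by blast

lemma finite_cross: "finite L \<Longrightarrow> finite R \<Longrightarrow> finite (cross L R)"
  by (rule finite_subset[of _ "Pow (L \<union> R)"]) (auto simp: cross_def)

text \<open>The parameter \<open>d\<close> stands for \<open>n\<^sup>r\<^sup>/\<^sup>s\<close>, and \<open>\<beta>\<close> will bound the number of neighbours in the
  energy graph that meet a given set of \<open>2p\<close> vertices. The assumption \<open>saving\<close> is what the colouring
  condition says about \<open>p\<close> vertices on either side, with \<open>S = (r - 1)st\<close>.\<close>

locale few_colors =
  fixes L R :: "'a set" and c :: "'a set \<Rightarrow> nat" and n C p S r s t h \<beta> :: nat and d :: real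
  assumes fin: "finite L" "finite R" and disj: "L \<inter> R = {}" and card_LR: "card L = n" "card R = n"
    and colors: "c ` cross L R \<subseteq> {..<C}"
    and saving: "\<And>F. \<lbrakk>F \<subseteq> cross L R; card (\<Union>F \<inter> L) \<le> p; card (\<Union>F \<inter> R) \<le> p\<rbrakk>
      \<Longrightarrow> card F + 2 \<le> card (c ` F) + S"
    and r3: "r \<ge> 3" and t2: "t \<ge> 2" and rh: "r \<le> h + 1"
    and s_def: "s = 2 * h + 1" and p_def: "p = r * (h * t + 1)" and S_def: "S = (r - 1) * s * t"
    and \<beta>_def: "\<beta> = 2 * p * r * p ^ r"
    and d1: "d \<ge> 1" and ds: "d ^ s = real n ^ r"
    and few: "real ((8 * p * r) ^ r * 12 * \<beta>) * d * real C ^ (r - 1) < real n ^ r"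
begin

abbreviation "E \<equiv> cross L R"

definition nb :: "'a \<Rightarrow> nat \<Rightarrow> 'a set" where
  "nb v \<chi> = {u. {v, u} \<in> E \<and> c {v, u} = \<chi>}"

text \<open>The assumptions are symmetric in the two sides, so facts shown for \<open>L\<close>
  transfer to \<open>R\<close>.\<close>

lemma swap: "few_colors R L c n C p S r s t h \<beta> d"
  by unfold_locales
    (use fin disj card_LR colors saving r3 t2 rh s_def p_def S_def \<beta>_def d1 ds few
      in \<open>auto simp: cross_commute[of R L]\<close>)

lemma nb_swap: "few_colors.nb R L c = nb"
  unfolding few_colors.nb_def[OF swap] nb_def[abs_def] by (simp add: cross_commute[of R L])

lemma nb_L: "x \<in> L \<Longrightarrow> nb x \<chi> \<subseteq> R"
  using disj unfolding nb_def by (auto simp: cross_doubleton_iff)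

lemma nb_R: "y \<in> R \<Longrightarrow> nb y \<chi> \<subseteq> L"
  using disj unfolding nb_def by (auto simp: cross_doubleton_iff)

lemma nb_sub: "nb v \<chi> \<subseteq> L \<union> R"
  unfolding nb_def by (auto simp: cross_doubleton_iff)

lemma finite_nb: "finite (nb v \<chi>)"
  using fin finite_subset[OF nb_sub] by blast

lemma finite_E: "finite E"
  using fin by (rule finite_cross)

section \<open>Arithmetic of the parameters\<close>

lemma p_ge: "p \<ge> r" "p \<ge> 1" "p \<ge> h * t + 1"
proof -
  have "r * 1 \<le> p" unfolding p_def by (rule mult_le_mono2) simp
  then show "p \<ge> r" "p \<ge> 1" using r3 by auto
  show "p \<ge> h * t + 1" unfolding p_def using r3 by (cases r) simp_all
qed

lemma \<beta>_ge: "\<beta> \<ge> p" "\<beta> \<ge> 1"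
proof -
  have "p * 1 \<le> p * (2 * r * p ^ r)"
    using r3 p_ge by (intro mult_le_mono2) (simp add: Suc_le_eq)
  then show "\<beta> \<ge> p" unfolding \<beta>_def by (simp add: ac_simps)
  then show "\<beta> \<ge> 1" using p_ge by linarith
qed

lemma n_pos: "n > 0"
proof (rule ccontr)
  assume "\<not> n > 0"
  then have "real n ^ r = 0" using r3 by simp
  moreover have "0 \<le> real ((8 * p * r) ^ r * 12 * \<beta>) * d * real C ^ (r - 1)"
    using d1 by (intro mult_nonneg_nonneg) auto
  ultimately show False using few by linarith
qed

lemma C_pos: "C \<ge> 1"
proof -
  obtain x y where "x \<in> L" "y \<in> R" using n_pos card_LR by (metis card_gt_0_iff ex_in_conv)
  then have "c {x, y} \<in> {..<C}" using colors crossI[of x L y R] by blast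
  then show ?thesis by simp
qed

text \<open>Take \<open>(r - 1)\<close>-st roots in \<open>few\<close>, using
  \<open>r <= 2 * (r - 1)\<close>. The result supplies the hypothesis \<open>large\<close> in both
  uses of \<open>moment_lower_bound\<close>.\<close>

lemma C_small: "8 * p * r * C \<le> n ^ 2"
proof -
  have "real (8 * p * r * C) ^ (r - 1)
      = real ((8 * p * r) ^ (r - 1)) * 1 * real C ^ (r - 1)"
    by (simp add: power_mult_distrib)
  also have "\<dots> \<le> real ((8 * p * r) ^ r * 12 * \<beta>) * d * real C ^ (r - 1)"
  proof (intro mult_right_mono mult_mono)
    have "(8 * p * r) ^ (r - 1) * 1 \<le> (8 * p * r) ^ r * (12 * \<beta>)"
      using p_ge r3 \<beta>_ge by (intro mult_le_mono power_increasing) (auto simp: Suc_le_eq)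
    then show "real ((8 * p * r) ^ (r - 1)) \<le> real ((8 * p * r) ^ r * 12 * \<beta>)"
      by (simp only: of_nat_le_iff mult.assoc mult_1_right)
  qed (use d1 in auto)
  also have "\<dots> < real n ^ r" by (rule few)
  also have "\<dots> \<le> real n ^ (2 * (r - 1))"
    using n_pos r3 by (intro power_increasing) auto
  also have "\<dots> = (real n ^ 2) ^ (r - 1)" by (rule power_mult)
  finally have "real (8 * p * r * C) < real n ^ 2"
    by (rule power_less_imp_less_base) simp
  then have "real (8 * p * r * C) < real (n ^ 2)" by simp
  then show ?thesis by (simp only: of_nat_less_iff less_imp_le)
qed

text \<open>The right side is what \<open>moment_lower_bound\<close> yields for classes of total
  size \<open>n ^ 2 / a\<close>. Here \<open>a\<close> will be 1 for classes of edges and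
  \<open>p\<close> for classes of vertices on one side.\<close>

lemma moment_large:
  fixes x :: real and a :: nat
  assumes "a \<ge> 1" "x \<ge> 0" "x * real (4 * a) ^ r * real C ^ (r - 1) < real n ^ r"
  shows "x * real n ^ r
    < real n ^ 2 / real a / 4 * (real n ^ 2 / real a / (4 * real C)) ^ (r - 1)"
proof -
  obtain q where q: "r = Suc q" using r3 by (cases r) auto
  have pos: "real (4 * a) ^ r * real C ^ (r - 1) > 0" using assms(1) C_pos by simp
  have "real n ^ 2 / real a / 4 * (real n ^ 2 / real a / (4 * real C)) ^ (r - 1)
     = (real n ^ 2) ^ r / (real (4 * a) ^ r * real C ^ (r - 1))"
    using assms(1) C_pos by (simp add: q power_divide power_mult_distrib)
  also have "(real n ^ 2) ^ r = real n ^ r * real n ^ r"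
    by (simp add: power2_eq_square power_mult_distrib)
  finally have eq: "real n ^ 2 / real a / 4 * (real n ^ 2 / real a / (4 * real C)) ^ (r - 1)
     = real n ^ r * real n ^ r / (real (4 * a) ^ r * real C ^ (r - 1))" .
  have "x * real n ^ r * (real (4 * a) ^ r * real C ^ (r - 1))
     = (x * real (4 * a) ^ r * real C ^ (r - 1)) * real n ^ r" by simp
  also have "\<dots> < real n ^ r * real n ^ r"
    using assms(3) n_pos by (intro mult_strict_right_mono) auto
  finally show ?thesis unfolding eq using pos by (simp add: pos_less_divide_eq)
qed

text \<open>\<open>12 * \<beta> * d\<close> is the demand of \<open>dense_subgraph\<close>; the
  smaller demand \<open>h * t\<close> of \<open>no_left_star\<close> fits under it.\<close>

lemma few_scaled:
  assumes "0 \<le> x" "x \<le> 12 * real \<beta> * d" "a \<le> p" 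
  shows "x * real (4 * a) ^ r * real C ^ (r - 1) < real n ^ r"
proof -
  have "4 * a \<le> 8 * p * r" using assms(3) r3 mult_le_mono[of "4 * a" "8 * p" 1 r] by simp
  then have "real (4 * a) \<le> real (8 * p * r)" by (simp only: of_nat_le_iff)
  then have "x * real (4 * a) ^ r * real C ^ (r - 1)
      \<le> (12 * real \<beta> * d) * real (8 * p * r) ^ r * real C ^ (r - 1)"
    using assms(1,2) d1 by (intro mult_right_mono mult_mono power_mono) auto
  also have "\<dots> = real ((8 * p * r) ^ r * 12 * \<beta>) * d * real C ^ (r - 1)" by simp
  also note few
  finally show ?thesis .
qed

section \<open>Monochromatic stars have few leaves\<close>

text \<open>Together the stars would give \<open>2 * (p - 1)\<close> edges in at most 2 colours.
  This saves too much, because \<open>2 * p - 2 - S = 2 * (r - 1) + (s - r) * t\<close> is positive.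
  Hence at most one side carries stars with \<open>p\<close> leaves.\<close>

lemma no_two_sided_stars:
  assumes "x \<in> L" "y \<in> R" "p \<le> card (nb x \<chi>)" "p \<le> card (nb y \<chi>')"
  shows False
proof -
  \<comment> \<open>Removing the opposite centre from the leaves keeps the stars edge-disjoint and
    leaves room for both centres among \<open>p\<close> vertices per side.\<close>
  have "p - 1 \<le> card (nb x \<chi> - {y})" "p - 1 \<le> card (nb y \<chi>' - {x})"
    using assms(3,4) card_Diff1_le[of "nb x \<chi>" y] by (auto simp: card_Diff_singleton_if)
  then obtain B A where B: "B \<subseteq> nb x \<chi> - {y}" "card B = p - 1" "finite B"
    and A: "A \<subseteq> nb y \<chi>' - {x}" "card A = p - 1" "finite A"
    by (meson obtain_subset_with_card_n)
  have BR: "B \<subseteq> R" and AL: "A \<subseteq> L" using B A nb_L[OF assms(1)] nb_R[OF assms(2)] by blast+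
  have xy: "x \<notin> R" "y \<notin> L" using assms(1,2) disj by auto
  let ?F1 = "(\<lambda>b. {x, b}) ` B" and ?F2 = "(\<lambda>a. {y, a}) ` A"
  have "card ?F1 = p - 1" using B(2) by (subst card_image) (auto simp: inj_on_def doubleton_eq_iff)
  moreover have "card ?F2 = p - 1"
    using A(2) by (subst card_image) (auto simp: inj_on_def doubleton_eq_iff)
  moreover have "y \<notin> B" "x \<notin> A" using B A by auto
  then have "?F1 \<inter> ?F2 = {}" using xy \<open>x \<in> L\<close> by (auto simp: doubleton_eq_iff)
  ultimately have F: "card (?F1 \<union> ?F2) = 2 * (p - 1)"
    using A(3) B(3) by (subst card_Un_disjoint) auto
  have "c ` (?F1 \<union> ?F2) \<subseteq> {\<chi>, \<chi>'}" using A(1) B(1) by (auto simp: nb_def)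
  then have cF: "card (c ` (?F1 \<union> ?F2)) \<le> 2"
    using card_mono[of "{\<chi>, \<chi>'}" "c ` (?F1 \<union> ?F2)"] card_insert_le_m1[of 2 "{\<chi>'}" \<chi>] by simp
  have "\<Union>(?F1 \<union> ?F2) \<inter> L \<subseteq> insert x A" using xy BR disj by auto
  then have l: "card (\<Union>(?F1 \<union> ?F2) \<inter> L) \<le> p"
    using card_mono[of "insert x A" "\<Union>(?F1 \<union> ?F2) \<inter> L"] card_insert_le_m1[of p A x] A p_ge by simp
  have "\<Union>(?F1 \<union> ?F2) \<inter> R \<subseteq> insert y B" using xy AL disj by auto
  then have rr: "card (\<Union>(?F1 \<union> ?F2) \<inter> R) \<le> p"
    using card_mono[of "insert y B" "\<Union>(?F1 \<union> ?F2) \<inter> R"] card_insert_le_m1[of p B y] B p_ge by simp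
  have "?F1 \<union> ?F2 \<subseteq> E" using A(1) B(1) by (auto simp: nb_def)
  from saving[OF this l rr] F cF have "2 * (p - 1) \<le> S" by linarith
  then have le: "2 * p \<le> S + 2" by simp
  \<comment> \<open>The parameters \<open>q\<close> and \<open>w\<close> encode
    \<open>r >= 3\<close> and \<open>h >= r - 1\<close>, so that no truncated subtraction
    remains.\<close>
  obtain q where q: "r = q + 3" using r3 le_Suc_ex by (metis add.commute)
  obtain w where w: "h = q + 2 + w" using rh q le_Suc_ex[of "q + 2" h] by auto
  show False using le unfolding S_def p_def s_def q w by (simp add: algebra_simps)
qed

text \<open>An \<open>r\<close>-tuple on the right with \<open>ht\<close> common colours saves \<open>(r - 1)ht\<close> colours, and
  \<open>p - r = rht\<close> leaves of one monochromatic star save \<open>rht - 1\<close> more; \<open>s \<ge> 2r - 1\<close> makes this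
  too much.\<close>

lemma no_left_star:
  assumes deg: "\<And>y \<chi>. y \<in> R \<Longrightarrow> card (nb y \<chi>) < p" and "x \<in> L"
  shows "card (nb x \<chi>\<^sub>0) < p"
proof (rule ccontr)
  assume star: "\<not> card (nb x \<chi>\<^sub>0) < p"
  define D where "D = (\<lambda>\<chi>. {y \<in> R. nb y \<chi> \<noteq> {}})"
  \<comment> \<open>Each colour covers fewer than \<open>p\<close> of the \<open>n\<close> edges at
    \<open>y\<close>, so \<open>y\<close> sees at least \<open>n / p\<close> colours.\<close>
  have many: "n \<le> p * card {\<chi>\<in>{..<C}. nb y \<chi> \<noteq> {}}" if "y \<in> R" for y
  proof -
    let ?G = "{\<chi>\<in>{..<C}. nb y \<chi> \<noteq> {}}"
    have "L \<subseteq> (\<Union>\<chi>\<in>?G. nb y \<chi>)"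
    proof
      fix u assume "u \<in> L"
      then have "{y, u} \<in> E" using that by (rule crossI'[rotated])
      then have "u \<in> nb y (c {y, u})" "c {y, u} < C" using colors by (auto simp: nb_def)
      then show "u \<in> (\<Union>\<chi>\<in>?G. nb y \<chi>)" by blast
    qed
    then have "n \<le> card (\<Union>\<chi>\<in>?G. nb y \<chi>)"
      unfolding card_LR(1)[symmetric] by (rule card_mono[rotated]) (auto simp: finite_nb)
    also have "\<dots> \<le> (\<Sum>\<chi>\<in>?G. card (nb y \<chi>))" by (rule card_UN_le) simp
    also have "\<dots> \<le> (\<Sum>\<chi>\<in>?G. p)" using deg[OF that] by (intro sum_mono) (simp add: less_imp_le)
    finally show ?thesis by (simp add: mult.commute)
  qed
  have "n * n = (\<Sum>y\<in>R. n)" using card_LR by simp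
  also have "\<dots> \<le> (\<Sum>y\<in>R. p * card {\<chi>\<in>{..<C}. nb y \<chi> \<noteq> {}})" by (rule sum_mono) (rule many)
  also have "\<dots> = p * (\<Sum>\<chi><C. card (D \<chi>))"
    unfolding sum_distrib_left[symmetric] D_def using fin by (subst sum_card_swap) auto
  finally have "real (n * n) \<le> real (p * (\<Sum>\<chi><C. card (D \<chi>)))" by (simp only: of_nat_le_iff)
  then have W: "real n ^ 2 / real p \<le> real (\<Sum>\<chi><C. card (D \<chi>))"
    using p_ge by (simp add: field_simps power2_eq_square del: of_nat_sum)
  have "4 * real 1 * real r * real C \<le> real n ^ 2 / real p"
  proof -
    have "p * (4 * r * C) \<le> 8 * p * r * C" by simp
    then have "real (p * (4 * r * C)) \<le> real (n ^ 2)"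
      using C_small by (simp only: of_nat_le_iff)
    then show ?thesis using p_ge by (simp add: field_simps)
  qed
  \<comment> \<open>With equality as the conflict relation, this counts \<open>r\<close>-tuples of
    distinct right vertices that all see \<open>\<chi>\<close>.\<close>
  from moment_lower_bound[of C D "\<lambda>e e'. e = e'" 1 r, OF _ _ _ C_pos _ W this]
  have "real n ^ 2 / real p / 4 * (real n ^ 2 / real p / (4 * real C)) ^ (r - 1)
    \<le> real (\<Sum>\<chi><C. card {es. set es \<subseteq> D \<chi> \<and> length es = r \<and> sorted_wrt (\<lambda>e' e. \<not> e = e') es})"
    using fin r3 by (simp add: D_def card_le_Suc0_iff_eq del: of_nat_sum)
  also have "\<dots> \<le> real (\<Sum>\<chi><C. card {es \<in> {es. set es \<subseteq> R \<and> length es = r}. set es \<subseteq> D \<chi> \<and> distinct es})"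
    unfolding of_nat_le_iff
  proof (intro sum_mono card_mono)
    show "finite {es \<in> {es. set es \<subseteq> R \<and> length es = r}. set es \<subseteq> D \<chi> \<and> distinct es}" for \<chi>
      by (rule finite_subset[OF _ finite_lists_length_eq[OF fin(2), of r]]) auto
  qed (auto intro: sorted_wrt_neq_distinct simp: D_def)
  also have "\<dots> = real (\<Sum>es\<in>{es. set es \<subseteq> R \<and> length es = r}.
      card {\<chi>\<in>{..<C}. set es \<subseteq> D \<chi> \<and> distinct es})"
    using fin by (subst sum_card_swap) (auto intro: finite_lists_length_eq)
  finally have up: "real n ^ 2 / real p / 4 * (real n ^ 2 / real p / (4 * real C)) ^ (r - 1) \<le> \<dots>" .
  have "real (h * t) \<le> 12 * real \<beta> * d"
  proof -
    have "h * t \<le> \<beta>" using p_ge \<beta>_ge by linarith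
    then have "real (h * t) * 1 \<le> (12 * real \<beta>) * d" using d1 by (intro mult_mono) linarith+
    then show ?thesis by simp
  qed
  from moment_large[OF p_ge(2) _ few_scaled[OF _ this order_refl]] up
  have "real (h * t * n ^ r) < real (\<Sum>es\<in>{es. set es \<subseteq> R \<and> length es = r}.
      card {\<chi>\<in>{..<C}. set es \<subseteq> D \<chi> \<and> distinct es})"
    by simp
  then have lt: "h * t * n ^ r < (\<Sum>es\<in>{es. set es \<subseteq> R \<and> length es = r}.
      card {\<chi>\<in>{..<C}. set es \<subseteq> D \<chi> \<and> distinct es})"
    by (simp only: of_nat_less_iff)
  \<comment> \<open>Averaging over the \<open>n ^ r\<close> lists.\<close>
  have "\<exists>ys. set ys \<subseteq> R \<and> length ys = r
      \<and> h * t < card {\<chi>\<in>{..<C}. set ys \<subseteq> D \<chi> \<and> distinct ys}"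
  proof (rule ccontr)
    assume "\<not> ?thesis"
    then have "(\<Sum>es\<in>{es. set es \<subseteq> R \<and> length es = r}.
      card {\<chi>\<in>{..<C}. set es \<subseteq> D \<chi> \<and> distinct es}) \<le> (\<Sum>es\<in>{es. set es \<subseteq> R \<and> length es = r}. h * t)"
      by (intro sum_mono) (simp add: not_less)
    also have "\<dots> = h * t * n ^ r" using fin card_LR by (simp add: card_lists_length_eq)
    finally show False using lt by linarith
  qed
  then obtain ys where ys: "set ys \<subseteq> R" "length ys = r"
    and cards: "h * t < card {\<chi>\<in>{..<C}. set ys \<subseteq> D \<chi> \<and> distinct ys}" by blast
  then have "{\<chi>\<in>{..<C}. set ys \<subseteq> D \<chi> \<and> distinct ys} \<noteq> {}" by (metis card.empty not_less_zero)
  then have "distinct ys" by blast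
  then have card_ys: "card (set ys) = r" using ys distinct_card by metis
  obtain \<Gamma> where \<Gamma>: "\<Gamma> \<subseteq> {\<chi>\<in>{..<C}. set ys \<subseteq> D \<chi> \<and> distinct ys}" "card \<Gamma> = h * t" "finite \<Gamma>"
    using cards by (meson less_imp_le obtain_subset_with_card_n)
  define f where "f = (\<lambda>\<chi> y. SOME u. u \<in> nb y \<chi>)"
  have f: "f \<chi> y \<in> nb y \<chi>" if "\<chi> \<in> \<Gamma>" "y \<in> set ys" for \<chi> y
  proof -
    have "nb y \<chi> \<noteq> {}" using that \<Gamma> by (auto simp: D_def)
    then show ?thesis unfolding f_def by (simp add: some_in_eq)
  qed
  have fL: "f \<chi> y \<in> L" if "\<chi> \<in> \<Gamma>" "y \<in> set ys" for \<chi> y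
    using f[OF that] nb_R ys that by blast
  \<comment> \<open>Together with \<open>ys\<close>, these leaves bring the right side to
    \<open>p\<close>; on the left, \<open>x\<close> and the at most \<open>r * h * t\<close> chosen
    neighbours of \<open>ys\<close> fit into \<open>p\<close>.\<close>
  have "p - r \<le> card (nb x \<chi>\<^sub>0) - card (set ys)" using star card_ys by simp
  also have "\<dots> \<le> card (nb x \<chi>\<^sub>0 - set ys)" by (rule diff_card_le_card_Diff) simp
  finally obtain B where B: "B \<subseteq> nb x \<chi>\<^sub>0 - set ys" "card B = p - r" "finite B"
    by (meson obtain_subset_with_card_n)
  have BR: "B \<subseteq> R" using B nb_L[OF \<open>x \<in> L\<close>] by blast
  have pr: "p - r = r * (h * t)" by (simp add: p_def)
  let ?F1 = "(\<lambda>(\<chi>, y). {y, f \<chi> y}) ` (\<Gamma> \<times> set ys)" and ?F2 = "(\<lambda>b. {x, b}) ` B"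
  \<comment> \<open>The vertices \<open>f \<chi> y\<close> may coincide, but an edge still
    determines its right end \<open>y\<close> and its colour \<open>\<chi>\<close>.\<close>
  have "inj_on (\<lambda>(\<chi>, y). {y, f \<chi> y}) (\<Gamma> \<times> set ys)"
  proof (rule inj_onI, clarify)
    fix \<chi> y \<chi>' y'
    assume *: "\<chi> \<in> \<Gamma>" "y \<in> set ys" "\<chi>' \<in> \<Gamma>" "y' \<in> set ys" "{y, f \<chi> y} = {y', f \<chi>' y'}"
    have "y \<noteq> f \<chi>' y'" using fL[of \<chi>' y'] * ys disj by blast
    then have "y = y'" using *(5) by (auto simp: doubleton_eq_iff)
    moreover have "c {y, f \<chi> y} = \<chi>" "c {y', f \<chi>' y'} = \<chi>'"
      using f[of \<chi> y] f[of \<chi>' y'] * by (auto simp: nb_def)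
    ultimately show "\<chi> = \<chi>' \<and> y = y'" using *(5) by metis
  qed
  then have "card ?F1 = h * t * r" using \<Gamma> card_ys by (simp add: card_image card_cartesian_product)
  moreover have "card ?F2 = p - r"
    using B(2) by (subst card_image) (auto simp: inj_on_def doubleton_eq_iff)
  moreover have "?F1 \<inter> ?F2 = {}"
  proof -
    have *: "y \<notin> {x, b}" if "y \<in> set ys" "b \<in> B" for y b
      using that B ys disj \<open>x \<in> L\<close> by blast
    have "e \<notin> ?F2" if "e \<in> ?F1" for e
    proof -
      from that obtain y where "y \<in> set ys" "y \<in> e" by auto
      then show ?thesis using * by auto
    qed
    then show ?thesis by (intro disjoint_iff[THEN iffD2] allI impI)
  qed
  ultimately have F: "card (?F1 \<union> ?F2) = 2 * r * (h * t)"
    using \<Gamma>(3) B(3) pr by (subst card_Un_disjoint) auto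
  have "c ` (?F1 \<union> ?F2) \<subseteq> insert \<chi>\<^sub>0 \<Gamma>" using f B(1) by (auto simp: nb_def)
  then have "card (c ` (?F1 \<union> ?F2)) \<le> card (insert \<chi>\<^sub>0 \<Gamma>)" using \<Gamma>(3) by (intro card_mono) auto
  also have "\<dots> \<le> h * t + 1" using \<Gamma> by (simp add: card_insert_if)
  finally have cF: "card (c ` (?F1 \<union> ?F2)) \<le> h * t + 1" .
  have "\<Union>(?F1 \<union> ?F2) \<inter> L \<subseteq> insert x ((\<lambda>(\<chi>, y). f \<chi> y) ` (\<Gamma> \<times> set ys))"
    using ys BR disj by auto
  then have "card (\<Union>(?F1 \<union> ?F2) \<inter> L) \<le> card (insert x ((\<lambda>(\<chi>, y). f \<chi> y) ` (\<Gamma> \<times> set ys)))"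
    using \<Gamma>(3) by (intro card_mono) auto
  also have "\<dots> \<le> card ((\<lambda>(\<chi>, y). f \<chi> y) ` (\<Gamma> \<times> set ys)) + 1"
    using \<Gamma>(3) by (simp add: card_insert_if)
  also have "\<dots> \<le> card (\<Gamma> \<times> set ys) + 1" using \<Gamma>(3) by (intro add_right_mono card_image_le) auto
  also have "\<dots> \<le> p" using \<Gamma> card_ys r3 by (simp add: card_cartesian_product p_def algebra_simps)
  finally have l: "card (\<Union>(?F1 \<union> ?F2) \<inter> L) \<le> p" .
  have "\<Union>(?F1 \<union> ?F2) \<inter> R \<subseteq> set ys \<union> B" using \<open>x \<in> L\<close> fL disj by auto
  then have "card (\<Union>(?F1 \<union> ?F2) \<inter> R) \<le> card (set ys \<union> B)" using B(3) by (intro card_mono) auto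
  also have "\<dots> \<le> p" using card_Un_le[of "set ys" B] B(2) card_ys p_ge(1) by simp
  finally have rr: "card (\<Union>(?F1 \<union> ?F2) \<inter> R) \<le> p" .
  have "?F1 \<union> ?F2 \<subseteq> E" using f B(1) by (auto simp: nb_def)
  \<comment> \<open>After cancellation this reads \<open>h * t + 1 <= (r - 1) * t\<close>, contrary
    to \<open>h >= r - 1\<close>.\<close>
  from saving[OF this l rr] F cF have "2 * r * (h * t) + 2 \<le> h * t + 1 + S" by linarith
  moreover obtain q where q: "r = Suc q" using r3 by (cases r) auto
  moreover have "q * t \<le> h * t" using rh q by (intro mult_le_mono1) simp
  ultimately show False unfolding S_def s_def by (simp add: algebra_simps)
qed

text \<open>If some right vertex has a star with \<open>p\<close> leaves,
  \<open>no_two_sided_stars\<close> protects the left side; otherwise \<open>no_left_star\<close>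
  applies. Right vertices then follow by \<open>swap\<close>.\<close>

lemma card_nb_left:
  assumes "x \<in> L"
  shows "card (nb x \<chi>) < p"
proof (cases "\<forall>y\<in>R. \<forall>\<chi>. card (nb y \<chi>) < p")
  case True
  then show ?thesis using no_left_star assms by blast
next
  case False
  then show ?thesis using no_two_sided_stars assms by (meson not_less)
qed

lemma card_nb_le: "card (nb v \<chi>) \<le> p"
proof -
  consider "v \<in> L" | "v \<in> R" | "v \<notin> L \<union> R" by blast
  then show ?thesis
  proof cases
    case 1
    then show ?thesis using card_nb_left by (simp add: less_imp_le)
  next
    case 2
    from few_colors.card_nb_left[OF swap this] show ?thesis by (simp add: nb_swap less_imp_le)
  next
    case 3
    then have "nb v \<chi> = {}" unfolding nb_def by (auto simp: cross_doubleton_iff)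
    then show ?thesis by simp
  qed
qed

lemma nb_sym: "u \<in> nb v \<chi> \<longleftrightarrow> v \<in> nb u \<chi>"
  unfolding nb_def by (simp add: insert_commute)

text \<open>The energy graph: its vertices are \<open>r\<close>-tuples from one side, and tuples are adjacent if
  all \<open>r\<close> edges between corresponding entries have the same colour.\<close>

definition T :: "'a set \<Rightarrow> 'a list set" where
  "T K = {u. set u \<subseteq> K \<and> length u = r \<and> distinct u}"

definition adj :: "'a list \<Rightarrow> 'a list \<Rightarrow> bool" where
  "adj u v \<longleftrightarrow> (\<exists>\<chi>. \<forall>j<r. v ! j \<in> nb (u ! j) \<chi>)"

abbreviation "V \<equiv> T L \<union> T R"

lemma adj_sym: "adj u v \<Longrightarrow> adj v u"
  unfolding adj_def using nb_sym by blast

lemma adj_side: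
  assumes "adj u v" "v \<in> V"
  shows "u \<in> T L \<Longrightarrow> v \<in> T R" "u \<in> T R \<Longrightarrow> v \<in> T L"
proof -
  obtain \<chi> where "v ! 0 \<in> nb (u ! 0) \<chi>" using assms(1) r3 unfolding adj_def by force
  moreover have "v ! 0 \<in> set v" "length u = r \<Longrightarrow> u ! 0 \<in> set u"
    using assms(2) r3 by (auto simp: T_def intro!: nth_mem)
  ultimately show "u \<in> T L \<Longrightarrow> v \<in> T R" "u \<in> T R \<Longrightarrow> v \<in> T L"
    using assms(2) disj nb_L nb_R by (auto simp: T_def) blast+
qed

lemma finite_T: "finite K \<Longrightarrow> finite (T K)"
  by (rule finite_subset[OF _ finite_lists_length_eq[of K r]]) (auto simp: T_def)

lemma card_T_le: "finite K \<Longrightarrow> card (T K) \<le> card K ^ r"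
  unfolding card_lists_length_eq[of K r, symmetric]
  by (rule card_mono) (auto simp: T_def finite_lists_length_eq)

lemma finite_V: "finite V"
  using fin finite_T by blast

section \<open>Degrees and edges of the energy graph\<close>

text \<open>A conflict is some \<open>a\<close> in \<open>A\<close> at a coordinate
  \<open>j\<close>: at most \<open>r * 2 * p\<close> choices. The common colour is then that of the
  edge from \<open>u ! j\<close> to \<open>a\<close>, and small stars leave at most \<open>p\<close>
  choices per coordinate. This is the origin of \<open>\<beta>\<close>.\<close>

lemma card_conflicting_le:
  assumes "finite A" "card A \<le> 2 * p"
  shows "card {v \<in> V. adj u v \<and> set v \<inter> A \<noteq> {}} \<le> \<beta>"
proof -
  let ?X = "\<lambda>(j, a). {v. length v = r \<and> (\<forall>i<r. v ! i \<in> nb (u ! i) (c {u ! j, a}))}"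
  have X: "finite (?X q)" "card (?X q) \<le> p ^ r" for q
    using card_lists_nth_le[of r "\<lambda>i. nb (u ! i) (c {u ! fst q, snd q})" p] finite_nb card_nb_le
    by (auto simp: case_prod_beta)
  have "{v \<in> V. adj u v \<and> set v \<inter> A \<noteq> {}} \<subseteq> (\<Union>q\<in>{..<r} \<times> A. ?X q)"
  proof
    fix v assume v: "v \<in> {v \<in> V. adj u v \<and> set v \<inter> A \<noteq> {}}"
    then have len: "length v = r" by (auto simp: T_def)
    obtain \<chi> where \<chi>: "\<And>j. j < r \<Longrightarrow> v ! j \<in> nb (u ! j) \<chi>" using v by (auto simp: adj_def)
    obtain j where j: "j < r" "v ! j \<in> A" using v len by (auto simp: in_set_conv_nth)
    have "c {u ! j, v ! j} = \<chi>" using \<chi>[OF j(1)] by (simp add: nb_def)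
    then have "v \<in> ?X (j, v ! j)" using len \<chi> by simp
    then show "v \<in> (\<Union>q\<in>{..<r} \<times> A. ?X q)" using j by blast
  qed
  then have "card {v \<in> V. adj u v \<and> set v \<inter> A \<noteq> {}} \<le> card (\<Union>q\<in>{..<r} \<times> A. ?X q)"
    using X(1) assms(1) by (intro card_mono finite_UN_I) auto
  also have "\<dots> \<le> (\<Sum>q\<in>{..<r} \<times> A. card (?X q))" using assms(1) by (intro card_UN_le) auto
  also have "\<dots> \<le> (\<Sum>q\<in>{..<r} \<times> A. p ^ r)" by (intro sum_mono X)
  also have "\<dots> = r * card A * p ^ r" by (simp add: card_cartesian_product)
  also have "\<dots> \<le> r * (2 * p) * p ^ r" using assms(2) by (intro mult_le_mono) auto
  also have "\<dots> = \<beta>" by (simp add: \<beta>_def)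
  finally show ?thesis .
qed

text \<open>A list of \<open>r\<close> disjoint edges of one colour is an adjacent pair of tuples:
  zipping recovers the edges, and any edge recovers the colour. By the star bound an edge meets at
  most \<open>2 * p\<close> edges of a given colour, which is the \<open>b\<close> of the moment
  estimate.\<close>

lemma many_adjacent_pairs:
  assumes "0 \<le> x" "x \<le> 12 * real \<beta> * d"
  shows "x * real n ^ r < real (card {(u, v) \<in> V \<times> V. adj u v})"
proof -
  define D where "D = (\<lambda>\<chi>. {e \<in> L \<times> R. snd e \<in> nb (fst e) \<chi>})"
  define bad where "bad = (\<lambda>e e'. fst e = (fst e' :: 'a) \<or> snd e = (snd e' :: 'a))"
  define M where
    "M = (\<lambda>\<chi>. {es. set es \<subseteq> D \<chi> \<and> length es = r \<and> sorted_wrt (\<lambda>e' e. \<not> bad e e') es})"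
  have finD: "finite (D \<chi>)" for \<chi> using fin by (auto simp: D_def)
  have one: "card {\<chi>\<in>{..<C}. snd e \<in> nb (fst e) \<chi>} = 1" if "e \<in> L \<times> R" for e
  proof -
    have "{fst e, snd e} \<in> E" using that by (auto intro: crossI)
    then have "{\<chi>\<in>{..<C}. snd e \<in> nb (fst e) \<chi>} = {c {fst e, snd e}}"
      using colors by (auto simp: nb_def)
    then show ?thesis by simp
  qed
  have "(\<Sum>\<chi><C. card (D \<chi>)) = (\<Sum>e\<in>L \<times> R. 1)"
    unfolding D_def using fin one by (subst sum_card_swap) auto
  also have "\<dots> = n ^ 2" using card_LR by (simp add: card_cartesian_product power2_eq_square)
  finally have W: "real n ^ 2 / real 1 \<le> real (\<Sum>\<chi><C. card (D \<chi>))" by simp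
  have bad: "card {e' \<in> D \<chi>. bad e e'} \<le> 2 * p" for e \<chi>
  proof -
    have "{e' \<in> D \<chi>. bad e e'}
        \<subseteq> Pair (fst e) ` nb (fst e) \<chi> \<union> (\<lambda>x. (x, snd e)) ` nb (snd e) \<chi>"
      by (auto simp: D_def bad_def nb_sym)
    then have "card {e' \<in> D \<chi>. bad e e'}
        \<le> card (Pair (fst e) ` nb (fst e) \<chi> \<union> (\<lambda>x. (x, snd e)) ` nb (snd e) \<chi>)"
      using finite_nb by (intro card_mono) auto
    also have "\<dots> \<le> card (Pair (fst e) ` nb (fst e) \<chi>) + card ((\<lambda>x. (x, snd e)) ` nb (snd e) \<chi>)"
      by (rule card_Un_le)
    also have "\<dots> \<le> card (nb (fst e) \<chi>) + card (nb (snd e) \<chi>)"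
      by (intro add_mono card_image_le finite_nb)
    also have "\<dots> \<le> 2 * p" using card_nb_le[of "fst e" \<chi>] card_nb_le[of "snd e" \<chi>] by linarith
    finally show ?thesis .
  qed
  have large: "4 * real (2 * p) * real r * real C \<le> real n ^ 2 / real 1"
  proof -
    have "real (8 * p * r * C) \<le> real (n ^ 2)" using C_small by (simp only: of_nat_le_iff)
    then show ?thesis by simp
  qed
  have "x * real n ^ r < real n ^ 2 / real 1 / 4 * (real n ^ 2 / real 1 / (4 * real C)) ^ (r - 1)"
    by (rule moment_large[OF _ _ few_scaled]) (use assms p_ge in auto)
  also have "\<dots> \<le> real (\<Sum>\<chi><C. card (M \<chi>))"
    unfolding M_def
    by (rule moment_lower_bound[where b = "2 * p"]) (use finD bad r3 C_pos W large in auto)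
  also have "(\<Sum>\<chi><C. card (M \<chi>)) = card (SIGMA \<chi>:{..<C}. M \<chi>)"
  proof -
    have "finite (M \<chi>)" for \<chi>
      by (rule finite_subset[OF _ finite_lists_length_eq[OF finD, of \<chi> r]]) (auto simp: M_def)
    then show ?thesis by simp
  qed
  also have "\<dots> = card ((\<lambda>(\<chi>, es). (map fst es, map snd es)) ` (SIGMA \<chi>:{..<C}. M \<chi>))"
  proof (rule card_image[symmetric], rule inj_onI, clarify)
    fix \<chi> es \<chi>' es'
    assume *: "es \<in> M \<chi>" "es' \<in> M \<chi>'" "map fst es = map fst es'" "map snd es = map snd es'"
    then have es: "es = es'" by (metis zip_map_fst_snd)
    have "es ! 0 \<in> set es" using *(1) r3 by (intro nth_mem) (auto simp: M_def)
    then have "es ! 0 \<in> D \<chi>" "es ! 0 \<in> D \<chi>'" using * es by (auto simp: M_def)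
    then show "\<chi> = \<chi>' \<and> es = es'" using es by (auto simp: D_def nb_def)
  qed
  also have "\<dots> \<le> card {(u, v) \<in> V \<times> V. adj u v}"
  proof (rule card_mono)
    show "finite {(u, v) \<in> V \<times> V. adj u v}"
      by (rule finite_subset[of _ "V \<times> V"]) (use finite_V in auto)
    show "(\<lambda>(\<chi>, es). (map fst es, map snd es)) ` (SIGMA \<chi>:{..<C}. M \<chi>)
        \<subseteq> {(u, v) \<in> V \<times> V. adj u v}"
    proof (rule image_subsetI)
      fix e assume "e \<in> (SIGMA \<chi>:{..<C}. M \<chi>)"
      then obtain \<chi> es where e: "e = (\<chi>, es)" and es: "es \<in> M \<chi>" by blast
      have "distinct (map fst es) \<and> distinct (map snd es)"
        if "sorted_wrt (\<lambda>e' e. \<not> bad e e') es"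
        using that by (induction es) (auto simp: bad_def)
      then have "map fst es \<in> T L" "map snd es \<in> T R" using es by (auto simp: M_def D_def T_def)
      moreover have "map snd es ! j \<in> nb (map fst es ! j) \<chi>" if "j < r" for j
      proof -
        have "es ! j \<in> set es" using es that by (intro nth_mem) (auto simp: M_def)
        then have "es ! j \<in> D \<chi>" using es by (auto simp: M_def)
        then show ?thesis using es that by (simp add: M_def D_def)
      qed
      then have "adj (map fst es) (map snd es)" unfolding adj_def by blast
      ultimately show "(case e of (\<chi>, es) \<Rightarrow> (map fst es, map snd es)) \<in> {(u, v) \<in> V \<times> V. adj u v}"
        by (simp add: e)
    qed
  qed
  finally show ?thesis by simp
qed

lemma dense_subgraph:
  obtains U \<delta> where "U \<subseteq> V" "U \<noteq> {}" "\<And>u. u \<in> U \<Longrightarrow> \<delta> \<le> card {v \<in> U. adj u v}"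
    "2 * real \<beta> * d < real \<delta>"
proof -
  \<comment> \<open>\<open>min_degree_subset\<close> asks for more than
    \<open>2 * \<delta> * card V\<close> pairs. With \<open>card V <= 2 * n ^ r\<close> and
    \<open>\<delta> <= 3 * \<beta> * d\<close>, this is where the 12 in \<open>few\<close> comes
    from.\<close>
  define \<delta> where "\<delta> = nat \<lfloor>2 * real \<beta> * d\<rfloor> + 1"
  have \<beta>d: "1 \<le> real \<beta> * d" using mult_mono[of 1 "real \<beta>" 1 d] \<beta>_ge d1 by simp
  then have \<delta>: "2 * real \<beta> * d < real \<delta>" "real \<delta> \<le> 3 * (real \<beta> * d)"
    unfolding \<delta>_def by linarith+
  have "card V \<le> n ^ r + n ^ r"
    using card_Un_le[of "T L" "T R"] card_T_le[OF fin(1)] card_T_le[OF fin(2)] card_LR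
    by simp
  then have "2 * \<delta> * card V \<le> 2 * \<delta> * (n ^ r + n ^ r)" by (rule mult_le_mono2)
  then have "real (2 * \<delta> * card V) \<le> real (2 * \<delta> * (n ^ r + n ^ r))" by (simp only: of_nat_le_iff)
  also have "\<dots> = 4 * real \<delta> * real n ^ r" by simp
  also have "\<dots> < real (card {(u, v) \<in> V \<times> V. adj u v})"
    by (rule many_adjacent_pairs) (use \<delta>(2) in \<open>auto simp: mult.commute\<close>)
  finally have "2 * \<delta> * card V < card {(u, v) \<in> V \<times> V. adj u v}" by (simp only: of_nat_less_iff)
  from min_degree_subset[of V adj \<delta>, OF finite_V adj_sym this] \<delta>(1) that show thesis by blast
qed

text \<open>Walks are listed with their start last, hence parity is measured from the end of the
  list.\<close>

lemma nth_alternates_sides: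
  assumes "successively adj q" "set q \<subseteq> V" "q \<noteq> []" "last q \<in> T L" "k < length q"
  shows "q ! k \<in> (if even (length q - Suc k) then T L else T R)"
  using assms
proof (induction q arbitrary: k)
  case (Cons u q)
  show ?case
  proof (cases q)
    case Nil
    then show ?thesis using Cons.prems by simp
  next
    case q: (Cons v q')
    have IH: "q ! i \<in> (if even (length q - Suc i) then T L else T R)" if "i < length q" for i
      using Cons.IH[of i] Cons.prems that q by simp
    show ?thesis
    proof (cases k)
      case 0
      have "adj v u" "u \<in> V" using Cons.prems q adj_sym by auto
      then have "v \<in> T L \<Longrightarrow> u \<in> T R" "v \<in> T R \<Longrightarrow> u \<in> T L" using adj_side by blast+
      then show ?thesis using IH[of 0] 0 q by (auto split: if_splits)
    next
      case (Suc i)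
      then show ?thesis using IH[of i] Cons.prems by simp
    qed
  qed
qed simp

section \<open>Generic walks in the energy graph\<close>

text \<open>Lists \<open>zs @ [z\<^sub>0]\<close> are walks from \<open>z\<^sub>0\<close>, the last vertex coming first. On a generic walk
  no two tuples share a coordinate.\<close>

definition generic_walk :: "'a list list \<Rightarrow> bool" where
  "generic_walk q \<longleftrightarrow> successively adj q \<and> sorted_wrt (\<lambda>u v. set u \<inter> set v = {}) q"

lemma set_V: "u \<in> V \<Longrightarrow> length u = r \<and> distinct u \<and> set u \<subseteq> L \<union> R"
  by (auto simp: T_def)

text \<open>The tuples of a walk with fewer than \<open>s\<close> steps have at most
  \<open>r * s\<close> entries in total, so \<open>card_conflicting_le\<close> applies to the set of
  these entries.\<close>

lemma p_ge_rs: "r * s \<le> 2 * p"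
proof -
  have "h * 1 \<le> h * t" using t2 by (intro mult_le_mono2) simp
  then have "2 * h \<le> 2 * (h * t)" by (intro mult_le_mono2) simp
  then have "s \<le> 2 * (h * t + 1)" unfolding s_def distrib_left
    by (rule add_mono) simp
  then have "r * s \<le> r * (2 * (h * t + 1))" by (rule mult_le_mono2)
  then show ?thesis by (simp add: p_def algebra_simps)
qed

text \<open>Of the at least \<open>\<delta>\<close> neighbours of the current tuple, at most
  \<open>\<beta>\<close> share an entry with the walk so far.\<close>

lemma many_generic_walks:
  assumes U: "U \<subseteq> V" and deg: "\<And>u. u \<in> U \<Longrightarrow> \<delta> \<le> card {v \<in> U. adj u v}" and z0: "z\<^sub>0 \<in> U"
  shows "(\<delta> - \<beta>) ^ s \<le> card {zs. set zs \<subseteq> U \<and> length zs = s \<and> generic_walk (zs @ [z\<^sub>0])}"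
proof (rule card_lists_ge_power)
  show finU: "finite U" using U finite_V finite_subset by blast
  show "generic_walk ([] @ [z\<^sub>0])" by (simp add: generic_walk_def)
  fix zs assume zs: "generic_walk (zs @ [z\<^sub>0])" "set zs \<subseteq> U" "length zs < s"
  let ?q = "zs @ [z\<^sub>0]"
  let ?A = "\<Union>u\<in>set ?q. set u"
  have q: "set ?q \<subseteq> U" using zs z0 by auto
  have "card ?A \<le> (\<Sum>u\<in>set ?q. card (set u))" by (rule card_UN_le) simp
  also have "\<dots> \<le> (\<Sum>u\<in>set ?q. r)"
  proof (rule sum_mono)
    fix u assume "u \<in> set ?q"
    then have "length u = r" using q U set_V by blast
    then show "card (set u) \<le> r" using card_length[of u] by simp
  qed
  also have "\<dots> = card (set ?q) * r" by simp
  also have "\<dots> \<le> s * r"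
    using card_length[of ?q] zs(3) by (intro mult_le_mono1) simp
  also have "\<dots> \<le> 2 * p" using p_ge_rs by (simp add: mult.commute)
  finally have A: "card ?A \<le> 2 * p" .
  let ?X = "{v \<in> V. adj (hd ?q) v \<and> set v \<inter> ?A \<noteq> {}}"
  have hd: "hd ?q \<in> U" using q hd_in_set[of ?q] by auto
  have "\<delta> - \<beta> \<le> card {v \<in> U. adj (hd ?q) v} - card ?X"
    using deg[OF hd] card_conflicting_le[of ?A "hd ?q", OF _ A] by simp
  also have "\<dots> \<le> card ({v \<in> U. adj (hd ?q) v} - ?X)"
    by (rule diff_card_le_card_Diff) (use finite_V in auto)
  also have "\<dots> \<le> card {z \<in> U. generic_walk ((z # zs) @ [z\<^sub>0])}"
  proof (rule card_mono)
    show "{v \<in> U. adj (hd ?q) v} - ?X \<subseteq> {z \<in> U. generic_walk ((z # zs) @ [z\<^sub>0])}"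
    proof
      fix z assume z: "z \<in> {v \<in> U. adj (hd ?q) v} - ?X"
      then have "adj z (hd ?q)" "set z \<inter> ?A = {}" using adj_sym U by auto
      then show "z \<in> {z \<in> U. generic_walk ((z # zs) @ [z\<^sub>0])}"
        using zs(1) z by (auto simp: generic_walk_def successively_Cons)
    qed
  qed (use finU in auto)
  finally show "\<delta> - \<beta> \<le> card {z \<in> U. generic_walk ((z # zs) @ [z\<^sub>0])}" .
qed

text \<open>At each step a tuple meeting \<open>A\<close> can be chosen in at most
  \<open>\<beta>\<close> ways. Being compared with \<open>popular_endpoint\<close>, the bound
  guarantees a walk with a tuple that avoids \<open>A\<close>.\<close>

lemma few_conflicting_walks:
  assumes U: "U \<subseteq> V" and z0: "z\<^sub>0 \<in> U" and A: "finite A" "card A \<le> 2 * p"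
  shows "card {zs. set zs \<subseteq> U \<and> length zs = k \<and> successively adj (zs @ [z\<^sub>0])
    \<and> (\<forall>z\<in>set zs. set z \<inter> A \<noteq> {})} \<le> \<beta> ^ k"
proof (rule card_lists_le_power)
  show "finite U" using U finite_V finite_subset by blast
next
  fix z zs assume "successively adj ((z # zs) @ [z\<^sub>0]) \<and> (\<forall>z\<in>set (z # zs). set z \<inter> A \<noteq> {})"
  then show "successively adj (zs @ [z\<^sub>0]) \<and> (\<forall>z\<in>set zs. set z \<inter> A \<noteq> {})"
    by (auto simp: successively_Cons)
next
  fix zs assume "set zs \<subseteq> U"
  let ?q = "zs @ [z\<^sub>0]"
  have "card {z \<in> U. successively adj ((z # zs) @ [z\<^sub>0]) \<and> (\<forall>z\<in>set (z # zs). set z \<inter> A \<noteq> {})}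
      \<le> card {v \<in> V. adj (hd ?q) v \<and> set v \<inter> A \<noteq> {}}"
    by (rule card_mono) (use finite_V U adj_sym in \<open>auto simp: successively_Cons\<close>)
  also have "\<dots> \<le> \<beta>" by (rule card_conflicting_le[OF A])
  finally show "card {z \<in> U. successively adj ((z # zs) @ [z\<^sub>0])
      \<and> (\<forall>z\<in>set (z # zs). set z \<inter> A \<noteq> {})} \<le> \<beta>" .
qed

text \<open>Since \<open>\<delta> - \<beta> > \<beta> * d\<close> and \<open>d ^ s = n ^ r\<close>,
  more than \<open>\<beta> ^ s * n ^ r\<close> generic walks share at most \<open>n ^ r\<close>
  endpoints. Oddness of \<open>s\<close> puts \<open>w\<close> on the right.\<close>

lemma popular_endpoint:
  assumes U: "U \<subseteq> V" and deg: "\<And>u. u \<in> U \<Longrightarrow> \<delta> \<le> card {v \<in> U. adj u v}"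
    and z0: "z\<^sub>0 \<in> U" "z\<^sub>0 \<in> T L" and \<delta>: "2 * real \<beta> * d < real \<delta>"
  obtains w where "w \<in> U" "w \<in> T R"
    "\<beta> ^ s < card {zs. set zs \<subseteq> U \<and> length zs = s \<and> generic_walk (zs @ [z\<^sub>0]) \<and> hd zs = w}"
proof -
  let ?P = "{zs. set zs \<subseteq> U \<and> length zs = s \<and> generic_walk (zs @ [z\<^sub>0])}"
  have hd: "hd zs \<in> U \<inter> T R" if "zs \<in> ?P" for zs
  proof -
    let ?q = "zs @ [z\<^sub>0]"
    have ne: "zs \<noteq> []" using that by (auto simp: s_def)
    have "?q ! 0 \<in> (if even (length ?q - Suc 0) then T L else T R)"
      by (rule nth_alternates_sides) (use that U z0 in \<open>auto simp: generic_walk_def\<close>)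
    then have "hd zs \<in> T R" using that ne by (simp add: s_def hd_conv_nth nth_append)
    then show ?thesis using that ne hd_in_set by blast
  qed
  have finP: "finite ?P"
    by (rule finite_subset[OF _ finite_lists_length_eq[of U s]])
      (use U finite_V finite_subset in auto)
  have "real \<beta> * 1 \<le> real \<beta> * d" using d1 by (intro mult_left_mono) auto
  then have "real \<beta> * d < real (\<delta> - \<beta>)" using \<delta> by linarith
  then have "(real \<beta> * d) ^ s < real (\<delta> - \<beta>) ^ s"
    using d1 by (intro power_strict_mono) (auto simp: s_def)
  then have "real (\<beta> ^ s * n ^ r) < real ((\<delta> - \<beta>) ^ s)" by (simp add: power_mult_distrib ds)
  then have "\<beta> ^ s * n ^ r < (\<delta> - \<beta>) ^ s" by (simp only: of_nat_less_iff)
  also have "\<dots> \<le> card ?P" by (rule many_generic_walks) (use U deg z0 in auto)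
  finally have lt: "\<beta> ^ s * n ^ r < card ?P" .
  have "\<exists>w\<in>U \<inter> T R. \<beta> ^ s < card {zs \<in> ?P. hd zs = w}"
  proof (rule ccontr)
    assume neg: "\<not> ?thesis"
    have fin': "finite (U \<inter> T R)" using finite_T[OF fin(2)] by blast
    have "?P \<subseteq> (\<Union>w\<in>U \<inter> T R. {zs \<in> ?P. hd zs = w})" using hd by auto
    then have "card ?P \<le> card (\<Union>w\<in>U \<inter> T R. {zs \<in> ?P. hd zs = w})"
      using fin' by (intro card_mono finite_UN_I finite_subset[OF _ finP]) auto
    also have "\<dots> \<le> (\<Sum>w\<in>U \<inter> T R. card {zs \<in> ?P. hd zs = w})" by (rule card_UN_le[OF fin'])
    also have "\<dots> \<le> (\<Sum>w\<in>U \<inter> T R. \<beta> ^ s)"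
      using neg by (intro sum_mono) (simp add: not_less)
    also have "\<dots> = card (U \<inter> T R) * \<beta> ^ s" by simp
    also have "\<dots> \<le> card (T R) * \<beta> ^ s"
      using finite_T[OF fin(2)] by (intro mult_le_mono1 card_mono) auto
    also have "\<dots> \<le> n ^ r * \<beta> ^ s"
      using card_T_le[OF fin(2)] card_LR by (intro mult_le_mono1) simp
    finally show False using lt by (simp add: mult.commute)
  qed
  then show thesis using that by auto
qed

section \<open>Adding walks, padding, and the contradiction\<close>

text \<open>The \<open>r\<close> coordinates trace parallel paths, to which
  \<open>potential_add_paths\<close> applies. One fresh tuple suffices, because every path passes
  through it and gets a new edge there. Between the end tuples, which lie in \<open>A\<close>
  already, there are \<open>h\<close> tuples per side.\<close>

lemma add_walk:
  assumes U: "U \<subseteq> V" and zs: "set zs \<subseteq> U" "length zs = s" "generic_walk (zs @ [z\<^sub>0])"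
    and z0: "z\<^sub>0 \<in> U" "z\<^sub>0 \<in> T L"
    and A: "A \<subseteq> L \<union> R" "F \<subseteq> E" "\<Union>F \<subseteq> A" "set z\<^sub>0 \<subseteq> A" "set (hd zs) \<subseteq> A"
    and fresh: "\<exists>z\<in>set zs. set z \<inter> A = {}"
  obtains A' F' where "A' \<subseteq> L \<union> R" "F' \<subseteq> E" "\<Union>F' \<subseteq> A'" "A \<subseteq> A'"
    "card (A' \<inter> L) \<le> card (A \<inter> L) + r * h" "card (A' \<inter> R) \<le> card (A \<inter> R) + r * h"
    "potential r c A F + int r * (int r - 1) \<le> potential r c A' F'"
proof -
  define q where "q = zs @ [z\<^sub>0]"
  define v where "v = (\<lambda>k j. q ! k ! j)"
  have lenq: "length q = Suc s" using zs by (simp add: q_def)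
  have qV: "q ! k \<in> V" if "k \<le> s" for k
  proof -
    have "q ! k \<in> set q" using that lenq by (intro nth_mem) simp
    then show ?thesis using zs z0 U by (auto simp: q_def)
  qed
  have side: "q ! k \<in> (if odd k then T L else T R)" if "k \<le> s" for k
  proof -
    have "q ! k \<in> (if even (length q - Suc k) then T L else T R)"
      by (rule nth_alternates_sides)
        (use zs z0 U that lenq in \<open>auto simp: q_def generic_walk_def\<close>)
    moreover have "even (length q - Suc k) \<longleftrightarrow> odd k" using that lenq by (simp add: s_def)
    ultimately show ?thesis by simp
  qed
  have ends: "q ! 0 = hd zs" "q ! s = z\<^sub>0"
    using zs(2) by (cases zs; simp add: q_def s_def nth_append)+
  have vset: "v k j \<in> set (q ! k)" if "k \<le> s" "j < r" for k j
    using that qV[OF that(1)] set_V by (simp add: v_def)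
  have "\<exists>\<chi>. k < s \<longrightarrow> (\<forall>j<r. v (Suc k) j \<in> nb (v k j) \<chi>)" for k
    using zs(3) lenq successively_conv_nth[of adj q] unfolding generic_walk_def adj_def v_def q_def
    by fastforce
  then obtain \<chi> where "\<forall>k. k < s \<longrightarrow> (\<forall>j<r. v (Suc k) j \<in> nb (v k j) (\<chi> k))" by metis
  then have \<chi>: "v (Suc k) j \<in> nb (v k j) (\<chi> k)" if "k < s" "j < r" for k j using that by blast
  have disjq: "set (q ! k) \<inter> set (q ! k') = {}" if "k < k'" "k' \<le> s" for k k'
    using zs(3) that lenq unfolding generic_walk_def q_def sorted_wrt_iff_nth_less by auto
  have inj: "k = k' \<and> j = j'"
    if *: "k \<le> s" "j < r" "k' \<le> s" "j' < r" "v k j = v k' j'" for k j k' j'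
  proof -
    have "k = k'"
      using disjq[of k k'] disjq[of k' k] vset[of k j] vset[of k' j'] *
      by (cases k k' rule: linorder_cases) auto
    moreover have "j = j'"
      using * \<open>k = k'\<close> qV[of k] set_V nth_eq_iff_index_eq[of "q ! k" j j'] by (auto simp: v_def)
    ultimately show ?thesis by simp
  qed
  obtain z where z: "z \<in> set zs" "set z \<inter> A = {}" using fresh by blast
  then obtain m where m: "m < s" "q ! m = z"
    using zs(2) unfolding q_def by (auto simp: in_set_conv_nth nth_append)
  let ?N = "(\<lambda>(k, j). v k j) ` ({..s} \<times> {..<r})"
  let ?M = "(\<lambda>(k, j). {v k j, v (Suc k) j}) ` ({..<s} \<times> {..<r})"
  have finA: "finite A" using A(1) fin finite_subset by blast
  have finF: "finite F" using A(2) finite_E finite_subset by blast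
  have in_side: "v k j \<in> (if odd k then L else R)" if "k \<le> s" "j < r" for k j
    using vset[OF that] side[OF that(1)] by (auto simp: T_def split: if_splits)
  \<comment> \<open>\<open>g\<close> enumerates the inner positions of one side: 1, 3, ..., 2h - 1
    on the left and 2, 4, ..., 2h on the right.\<close>
  have new_in: "card ((A \<union> ?N) \<inter> K) \<le> card (A \<inter> K) + r * h"
    if g: "\<And>k j. \<lbrakk>k \<le> s; j < r; v k j \<in> K; v k j \<notin> A\<rbrakk> \<Longrightarrow> \<exists>i<h. k = g i" for K g
  proof -
    let ?X = "(\<lambda>(i, j). v (g i) j) ` ({..<h} \<times> {..<r})"
    have "(A \<union> ?N) \<inter> K \<subseteq> (A \<inter> K) \<union> ?X"
    proof
      fix x assume x: "x \<in> (A \<union> ?N) \<inter> K"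
      show "x \<in> (A \<inter> K) \<union> ?X"
      proof (cases "x \<in> A")
        case False
        then obtain k j where kj: "k \<le> s" "j < r" "x = v k j" using x by auto
        then obtain i where "i < h" "k = g i" using g[of k j] False x by auto
        then have "x \<in> ?X" using kj by (intro image_eqI[of _ _ "(i, j)"]) auto
        then show ?thesis by blast
      qed (use x in blast)
    qed
    then have "card ((A \<union> ?N) \<inter> K) \<le> card ((A \<inter> K) \<union> ?X)" using finA by (intro card_mono) auto
    also have "\<dots> \<le> card (A \<inter> K) + card ?X" by (rule card_Un_le)
    also have "\<dots> \<le> card (A \<inter> K) + card ({..<h} \<times> {..<r})"
      by (intro add_left_mono card_image_le) auto
    also have "\<dots> = card (A \<inter> K) + r * h" by (simp add: card_cartesian_product)
    finally show ?thesis .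
  qed
  show thesis
  proof (rule that)
    show "potential r c A F + int r * (int r - 1) \<le> potential r c (A \<union> ?N) (F \<union> ?M)"
    proof (rule potential_add_paths[OF finA finF A(3) inj])
      show "c {v k j, v (Suc k) j} = \<chi> k" if "k < s" "j < r" for k j
        using \<chi>[OF that] by (simp add: nb_def)
      show "v 0 j \<in> A \<and> v s j \<in> A" if "j < r" for j
        using vset[of 0 j] vset[of s j] that ends A by auto
      show "\<exists>k<s. {v k j, v (Suc k) j} \<notin> F" if "j < r" for j
        using vset[of m j] m z(2) A(3) that by (intro exI[of _ m]) auto
    qed (use r3 in auto)
    show "A \<union> ?N \<subseteq> L \<union> R" using A(1) vset qV set_V by fastforce
    show "F \<union> ?M \<subseteq> E" using A(2) \<chi> by (auto simp: nb_def)
    show "\<Union>(F \<union> ?M) \<subseteq> A \<union> ?N"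
    proof -
      have "v k j \<in> ?N" if "k \<le> s" "j < r" for k j
        using that by (intro image_eqI[of _ _ "(k, j)"]) auto
      then have "{v k j, v (Suc k) j} \<subseteq> ?N" if "k < s" "j < r" for k j using that by simp
      then show ?thesis using A(3) by auto
    qed
    show "A \<subseteq> A \<union> ?N" by blast
    show "card ((A \<union> ?N) \<inter> L) \<le> card (A \<inter> L) + r * h"
    proof (rule new_in)
      fix k j assume *: "k \<le> s" "j < r" "v k j \<in> L" "v k j \<notin> A"
      then have "k \<noteq> s" using ends A(4) vset[of s j] by auto
      moreover have "odd k" using in_side[of k j] * disj by auto
      ultimately show "\<exists>i<h. k = 2 * i + 1" using *(1) by (auto simp: s_def elim!: oddE)
    qed
    show "card ((A \<union> ?N) \<inter> R) \<le> card (A \<inter> R) + r * h"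
    proof (rule new_in)
      fix k j assume *: "k \<le> s" "j < r" "v k j \<in> R" "v k j \<notin> A"
      then have "k \<noteq> 0" using ends A(5) vset[of 0 j] by (cases k) auto
      moreover have "even k" using in_side[of k j] * disj by (auto split: if_splits)
      ultimately obtain i where "k = 2 * i" "i \<noteq> 0" by (auto elim!: evenE)
      then show "\<exists>i<h. k = 2 * i + 2" using *(1) by (intro exI[of _ "i - 1"]) (auto simp: s_def)
    qed
  qed
qed

text \<open>As \<open>u\<close> has more than \<open>\<beta>\<close> neighbours in \<open>U\<close>,
  one of them avoids the at most \<open>2 * p\<close> vertices of \<open>A\<close>. Attaching it to
  \<open>u\<close> entry by entry is free unless it must be truncated to fit, which happens only in
  the last round and costs at most \<open>r - 1\<close>.\<close>

lemma pad_side: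
  assumes U: "U \<subseteq> V" and deg: "\<And>u. u \<in> U \<Longrightarrow> \<beta> < card {v \<in> U. adj u v}"
    and u: "u \<in> U" "\<And>v. \<lbrakk>v \<in> U; adj u v\<rbrakk> \<Longrightarrow> set v \<subseteq> K"
    and A: "A \<subseteq> L \<union> R" "F \<subseteq> E" "\<Union>F \<subseteq> A" "set u \<subseteq> A"
    and cards: "card (A \<inter> K) \<le> p" "card (A - K) \<le> p"
  shows "\<exists>A' F'. A \<subseteq> A' \<and> A' \<subseteq> L \<union> R \<and> A' - A \<subseteq> K \<and> F' \<subseteq> E \<and> \<Union>F' \<subseteq> A' \<and> card (A' \<inter> K) = p
    \<and> potential r c A F - (int r - 1) \<le> potential r c A' F'"
  using A cards
proof (induction "p - card (A \<inter> K)" arbitrary: A F rule: less_induct)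
  case less
  note A = less.prems(1-4)
  show ?case
  proof (cases "card (A \<inter> K) = p")
    case True
    then show ?thesis using A r3 by (intro exI[of _ A] exI[of _ F]) auto
  next
    case False
    define \<rho> where "\<rho> = min r (p - card (A \<inter> K))"
    have \<rho>: "1 \<le> \<rho>" "\<rho> \<le> r" "card (A \<inter> K) + \<rho> \<le> p"
      using False less.prems(5) r3 by (auto simp: \<rho>_def)
    have finA: "finite A" using A(1) fin finite_subset by blast
    have finF: "finite F" using A(2) finite_E finite_subset by blast
    have "card A = card (A \<inter> K) + card (A - K)"
      using finA by (metis card_Int_Diff)
    then have "card {v \<in> V. adj u v \<and> set v \<inter> A \<noteq> {}} \<le> \<beta>"
      using less.prems(5,6) by (intro card_conflicting_le finA) simp
    then have "\<not> {v \<in> U. adj u v} \<subseteq> {v \<in> V. adj u v \<and> set v \<inter> A \<noteq> {}}"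
      using deg[OF u(1)] card_mono[of "{v \<in> V. adj u v \<and> set v \<inter> A \<noteq> {}}" "{v \<in> U. adj u v}"]
        finite_V by auto
    then obtain v where v: "v \<in> U" "adj u v" "set v \<inter> A = {}" using U by blast
    have lens: "length v = r" "distinct v" "length u = r" using v(1) u(1) U set_V by blast+
    obtain \<chi> where \<chi>: "\<And>j. j < r \<Longrightarrow> v ! j \<in> nb (u ! j) \<chi>" using v(2) by (auto simp: adj_def)
    let ?Y = "(!) v ` {..<\<rho>}" and ?M = "(\<lambda>j. {u ! j, v ! j}) ` {..<\<rho>}"
    have Y: "?Y \<subseteq> set v" using lens \<rho>(2) by auto
    have YK: "?Y \<subseteq> K" using Y u(2) v by blast
    have injY: "inj_on ((!) v) {..<\<rho>}"
      using lens \<rho>(2) by (auto simp: inj_on_def nth_eq_iff_index_eq)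
    have step: "potential r c A F + int \<rho> - int r \<le> potential r c (A \<union> ?Y) (F \<union> ?M)"
    proof (rule potential_add_parallel_edges[OF finA finF A(3) injY])
      show "?Y \<inter> A = {}" using Y v(3) by blast
      show "u ! j \<in> A" if "j < \<rho>" for j using that \<rho>(2) lens A(4) by auto
      show "c {u ! j, v ! j} = \<chi>" if "j < \<rho>" for j
        using \<chi>[of j] that \<rho>(2) by (simp add: nb_def)
    qed
    have "card ((A \<union> ?Y) \<inter> K) = card ((A \<inter> K) \<union> ?Y)" using YK by (intro arg_cong[of _ _ card]) blast
    also have "\<dots> = card (A \<inter> K) + \<rho>"
      using finA Y v(3) injY by (subst card_Un_disjoint) (auto simp: card_image)
    finally have cardK: "card ((A \<union> ?Y) \<inter> K) = card (A \<inter> K) + \<rho>" .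
    have diff: "(A \<union> ?Y) - K = A - K" using YK by blast
    have A1: "A \<union> ?Y \<subseteq> L \<union> R" "F \<union> ?M \<subseteq> E" "\<Union>(F \<union> ?M) \<subseteq> A \<union> ?Y" "set u \<subseteq> A \<union> ?Y"
    proof -
      show "A \<union> ?Y \<subseteq> L \<union> R" using A(1) Y v(1) U set_V by blast
      show "F \<union> ?M \<subseteq> E" using A(2) \<chi> \<rho>(2) by (auto simp: nb_def)
      have "{u ! j, v ! j} \<subseteq> A \<union> ?Y" if "j < \<rho>" for j
        using that \<rho>(2) lens A(4) nth_mem[of j u] by auto
      then show "\<Union>(F \<union> ?M) \<subseteq> A \<union> ?Y" using A(3) by auto
    qed (use A(4) in blast)
    show ?thesis
    proof (cases "card (A \<inter> K) + \<rho> = p")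
      case True
      show ?thesis
        using A1 step \<rho>(1) True cardK YK
        by (intro exI[of _ "A \<union> ?Y"] exI[of _ "F \<union> ?M"]) auto
    next
      case False
      then have "\<rho> = r" unfolding \<rho>_def using less.prems(5) by (auto simp: min_def split: if_splits)
      have "p - card ((A \<union> ?Y) \<inter> K) < p - card (A \<inter> K)" using cardK \<rho> by simp
      from less.hyps[OF this A1] cardK \<rho>(3) diff less.prems(6)
      obtain A' F' where *: "A \<union> ?Y \<subseteq> A'" "A' \<subseteq> L \<union> R" "A' - (A \<union> ?Y) \<subseteq> K" "F' \<subseteq> E" "\<Union>F' \<subseteq> A'"
        "card (A' \<inter> K) = p" "potential r c (A \<union> ?Y) (F \<union> ?M) - (int r - 1) \<le> potential r c A' F'"
        by auto
      have "A' - A \<subseteq> K" using *(3) YK by blast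
      then show ?thesis
        using * step \<open>\<rho> = r\<close> by (intro exI[of _ A'] exI[of _ F']) auto
    qed
  qed
qed

text \<open>Every walk added between the fixed end tuples raises the potential by \<open>r(r - 1)\<close>; padding
  costs at most \<open>r - 1\<close> on either side. The result would save more than \<open>S - 2\<close> colours.\<close>

lemma contradiction: False
proof -
  obtain U \<delta> where U: "U \<subseteq> V" "U \<noteq> {}" and deg: "\<And>u. u \<in> U \<Longrightarrow> \<delta> \<le> card {v \<in> U. adj u v}"
    and \<delta>: "2 * real \<beta> * d < real \<delta>" by (rule dense_subgraph) (blast intro: that)
  have "real \<beta> * 1 \<le> real \<beta> * d" using d1 by (intro mult_left_mono) auto
  then have \<beta>\<delta>: "\<beta> < \<delta>" using \<delta> \<beta>_ge by linarith
  have "U \<inter> T L \<noteq> {}"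
  proof -
    obtain u where u: "u \<in> U" using U by blast
    have "{v \<in> U. adj u v} \<noteq> {}" using deg[OF u] \<beta>\<delta> by (metis card.empty le_zero_eq not_less_zero)
    then obtain v where "v \<in> U" "adj u v" by blast
    then show ?thesis using u U adj_side(2)[of u v] by blast
  qed
  then obtain z\<^sub>0 where z0: "z\<^sub>0 \<in> U" "z\<^sub>0 \<in> T L" by blast
  obtain w where w: "w \<in> U" "w \<in> T R"
    and pop: "\<beta> ^ s < card {zs. set zs \<subseteq> U \<and> length zs = s \<and> generic_walk (zs @ [z\<^sub>0]) \<and> hd zs = w}"
    by (rule popular_endpoint[OF U(1) deg z0 \<delta>]) (blast intro: that)+
  have r1: "r \<ge> 1" using r3 by simp
  have p_eq: "p = r + t * (r * h)" by (simp add: p_def algebra_simps)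
  have split: "card A = card (A \<inter> L) + card (A \<inter> R)" if "A \<subseteq> L \<union> R" for A
  proof -
    have "A = (A \<inter> L) \<union> (A \<inter> R)" using that by blast
    then show ?thesis using fin disj card_Un_disjoint[of "A \<inter> L" "A \<inter> R"] by auto
  qed
  \<comment> \<open>Invariant after \<open>i\<close> walks. The two end tuples alone have potential
    \<open>-2 * r * (r - 1)\<close>, hence \<open>i - 2\<close>; for \<open>i = t\<close> the bound
    on either side becomes \<open>p\<close>.\<close>
  have "\<exists>A F. A \<subseteq> L \<union> R \<and> F \<subseteq> E \<and> \<Union>F \<subseteq> A \<and> set z\<^sub>0 \<subseteq> A \<and> set w \<subseteq> A
      \<and> card (A \<inter> L) \<le> r + i * (r * h) \<and> card (A \<inter> R) \<le> r + i * (r * h)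
      \<and> int r * (int r - 1) * (int i - 2) \<le> potential r c A F" if "i \<le> t" for i
    using that
  proof (induction i)
    case 0
    let ?A = "set z\<^sub>0 \<union> set w"
    have zw: "set z\<^sub>0 \<subseteq> L" "set w \<subseteq> R" "card (set z\<^sub>0) = r" "card (set w) = r"
      using z0 w by (auto simp: T_def distinct_card)
    have LR: "?A \<inter> L = set z\<^sub>0" "?A \<inter> R = set w" using zw disj by auto
    have "?A \<subseteq> L \<union> R" using zw by blast
    from split[OF this] have "card ?A = 2 * r" using zw LR by simp
    then have "int r * (int r - 1) * (int 0 - 2) \<le> potential r c ?A {}"
      by (simp add: potential_def)
    then show ?case using zw LR by (intro exI[of _ ?A] exI[of _ "{}"]) auto
  next
    case (Suc i)
    then obtain A F where A: "A \<subseteq> L \<union> R" "F \<subseteq> E" "\<Union>F \<subseteq> A" "set z\<^sub>0 \<subseteq> A" "set w \<subseteq> A"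
      and cards: "card (A \<inter> L) \<le> r + i * (r * h)" "card (A \<inter> R) \<le> r + i * (r * h)"
      and pot: "int r * (int r - 1) * (int i - 2) \<le> potential r c A F" by auto
    have finA: "finite A" using A(1) fin finite_subset by blast
    have "i * (r * h) \<le> t * (r * h)" using Suc.prems by (intro mult_le_mono1) simp
    then have "card (A \<inter> L) \<le> p" "card (A \<inter> R) \<le> p"
      using cards unfolding p_eq by (meson add_left_mono le_trans)+
    then have "card A \<le> 2 * p" using split[OF A(1)] by simp
    from few_conflicting_walks[OF U(1) z0(1) finA this, of s] pop
    have "\<not> {zs. set zs \<subseteq> U \<and> length zs = s \<and> generic_walk (zs @ [z\<^sub>0]) \<and> hd zs = w}
        \<subseteq> {zs. set zs \<subseteq> U \<and> length zs = s \<and> successively adj (zs @ [z\<^sub>0])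
            \<and> (\<forall>z\<in>set zs. set z \<inter> A \<noteq> {})}" (is "\<not> ?X \<subseteq> ?Y")
    proof -
      have "finite ?Y"
        by (rule finite_subset[OF _ finite_lists_length_eq[of U s]])
          (use U finite_V finite_subset in auto)
      then show "\<beta> ^ s < card ?X \<Longrightarrow> card ?Y \<le> \<beta> ^ s \<Longrightarrow> \<not> ?X \<subseteq> ?Y"
        by (meson card_mono leD le_trans)
    qed
    \<comment> \<open>More than \<open>\<beta> ^ s\<close> walks lead to \<open>w\<close>, and at
      most \<open>\<beta> ^ s\<close> have all their tuples meeting \<open>A\<close>. As
      \<open>w\<close> itself meets \<open>A\<close>, the fresh tuple is an inner one.\<close>
    then obtain zs where zs: "set zs \<subseteq> U" "length zs = s" "generic_walk (zs @ [z\<^sub>0])" "hd zs = w"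
      and fresh: "\<exists>z\<in>set zs. set z \<inter> A = {}"
      by (auto simp: generic_walk_def)
    obtain A' F' where A': "A' \<subseteq> L \<union> R" "F' \<subseteq> E" "\<Union>F' \<subseteq> A'" "A \<subseteq> A'"
      "card (A' \<inter> L) \<le> card (A \<inter> L) + r * h" "card (A' \<inter> R) \<le> card (A \<inter> R) + r * h"
      "potential r c A F + int r * (int r - 1) \<le> potential r c A' F'"
      using add_walk[OF U(1) zs(1-3) z0 A(1-4) _ fresh] A(5) zs(4) by blast
    have "int r * (int r - 1) * (int (Suc i) - 2)
        = int r * (int r - 1) * (int i - 2) + int r * (int r - 1)"
      by (simp add: algebra_simps)
    then have "int r * (int r - 1) * (int (Suc i) - 2) \<le> potential r c A' F'"
      using A'(7) pot by linarith
    then show ?case using A A' cards by (intro exI[of _ A'] exI[of _ F']) auto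
  qed
  from this[of t] obtain A F where A: "A \<subseteq> L \<union> R" "F \<subseteq> E" "\<Union>F \<subseteq> A" "set z\<^sub>0 \<subseteq> A" "set w \<subseteq> A"
    and cards: "card (A \<inter> L) \<le> p" "card (A \<inter> R) \<le> p"
    and pot: "int r * (int r - 1) * (int t - 2) \<le> potential r c A F" unfolding p_eq by auto
  have deg': "\<beta> < card {v \<in> U. adj u v}" if "u \<in> U" for u using deg[OF that] \<beta>\<delta> by linarith
  have AR: "A - R = A \<inter> L" using A(1) disj by blast
  have "set v \<subseteq> R" if "v \<in> U" "adj z\<^sub>0 v" for v
    using adj_side(1)[of z\<^sub>0 v] that z0 U by (auto simp: T_def)
  from pad_side[OF U(1) deg' z0(1) this A(1-4) cards(2)] cards(1) AR
  obtain A1 F1 where A1: "A \<subseteq> A1" "A1 \<subseteq> L \<union> R" "A1 - A \<subseteq> R" "F1 \<subseteq> E" "\<Union>F1 \<subseteq> A1"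
    "card (A1 \<inter> R) = p" "potential r c A F - (int r - 1) \<le> potential r c A1 F1" by auto
  have AL: "A1 \<inter> L = A \<inter> L" "A1 - L = A1 \<inter> R" using A1(1,2,3) disj by blast+
  have "set v \<subseteq> L" if "v \<in> U" "adj w v" for v
    using adj_side(2)[of w v] that w U by (auto simp: T_def)
  moreover have "set w \<subseteq> A1" using A(5) A1(1) by blast
  ultimately have "\<exists>A' F'. A1 \<subseteq> A' \<and> A' \<subseteq> L \<union> R \<and> A' - A1 \<subseteq> L \<and> F' \<subseteq> E \<and> \<Union>F' \<subseteq> A'
      \<and> card (A' \<inter> L) = p \<and> potential r c A1 F1 - (int r - 1) \<le> potential r c A' F'"
    using pad_side[OF U(1) deg' w(1) _ A1(2,4,5)] A1(6) AL cards(1) by simp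
  then
  obtain A2 F2 where A2: "A1 \<subseteq> A2" "A2 \<subseteq> L \<union> R" "A2 - A1 \<subseteq> L" "F2 \<subseteq> E" "\<Union>F2 \<subseteq> A2"
    "card (A2 \<inter> L) = p" "potential r c A1 F1 - (int r - 1) \<le> potential r c A2 F2" by blast
  have A2R: "A2 \<inter> R = A1 \<inter> R" using A2(1,2,3) disj by blast
  have finA2: "finite A2" using A2(2) fin finite_subset by blast
  have "card F2 + 2 \<le> card (c ` F2) + S"
  proof (rule saving[OF A2(4)])
    show "card (\<Union>F2 \<inter> L) \<le> p"
      unfolding A2(6)[symmetric] using A2(5) finA2 by (intro card_mono) auto
    show "card (\<Union>F2 \<inter> R) \<le> p"
      unfolding A1(6)[symmetric] A2R[symmetric] using A2(5) finA2 by (intro card_mono) auto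
  qed
  then have "int r * (int (card F2) - int (card (c ` F2))) \<le> int r * (int S - 2)"
    by (intro mult_left_mono) auto
  moreover have "card A2 = 2 * p" using split[OF A2(2)] A2(6) A1(6) A2R by simp
  moreover have "int r * (int r - 1) * (int t - 2) - 2 * (int r - 1) \<le> potential r c A2 F2"
  proof -
    have "x - 2 * y \<le> c" if "x \<le> a" "a - y \<le> b" "b - y \<le> c" for x y a b c :: int
      using that by linarith
    from this[OF pot A1(7) A2(7)] show ?thesis .
  qed
  ultimately have le: "int r * (int r - 1) * (int t - 2) - 2 * (int r - 1)
      \<le> int r * (int S - 2) - (int r - 1) * int (2 * p)"
    unfolding potential_def by simp
  have S: "int S = (int r - 1) * (2 * int h + 1) * int t"
    unfolding S_def s_def of_nat_mult of_nat_diff[OF r1] by simp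
  \<comment> \<open>Without the padding loss the saving would be at least \<open>S\<close>. The loss
    of \<open>2 * (r - 1)\<close> in the potential is below \<open>2 * r\<close>, hence below 2 in
    the saving, so the saving still exceeds \<open>S - 2\<close>.\<close>
  have "int r * int S = int r * (int r - 1) * (int t - 2) + (int r - 1) * int (2 * p)"
    unfolding S p_def by (simp add: algebra_simps)
  moreover have False if "x - 2 * (y - 1) \<le> y * (z - 2) - w" "y * z = x + w" for x y z w :: int
    using that by (simp add: algebra_simps)
  ultimately show False using le by blast
qed

end

section \<open>The generalized Ramsey number\<close>

lemma graph_iso_card_edges:
  assumes "simple_graph S" "simple_graph H" "graph_iso S H"
  shows "card (edges S) = card (edges H)"
proof -
  obtain f where f: "bij_betw f (verts S) (verts H)"
    and e: "\<And>u v. \<lbrakk>u \<in> verts S; v \<in> verts S\<rbrakk> \<Longrightarrow> {u, v} \<in> edges S \<longleftrightarrow> {f u, f v} \<in> edges H"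
    using assms(3) unfolding graph_iso_def by blast
  have pair: "\<exists>a b. x = {a, b} \<and> a \<in> verts G \<and> b \<in> verts G"
    if "simple_graph G" "x \<in> edges G" for x and G :: "'c graph"
    using that unfolding simple_graph_def by (fastforce simp: card_2_iff)
  have "inj_on ((`) f) (edges S)"
  proof (rule inj_on_subset)
    show "inj_on ((`) f) (Pow (verts S))"
      using f by (intro inj_on_image_Pow) (simp add: bij_betw_def)
    show "edges S \<subseteq> Pow (verts S)" using assms(1) by (auto simp: simple_graph_def)
  qed
  moreover have "(`) f ` edges S = edges H"
  proof
    show "(`) f ` edges S \<subseteq> edges H"
    proof (rule image_subsetI)
      fix x assume "x \<in> edges S"
      with pair[OF assms(1) this] e show "f ` x \<in> edges H" by auto
    qed
    show "edges H \<subseteq> (`) f ` edges S"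
    proof
      fix y assume y: "y \<in> edges H"
      obtain a b where ab: "y = {a, b}" "a \<in> verts H" "b \<in> verts H"
        using pair[OF assms(2) y] by blast
      then obtain u v where uv: "u \<in> verts S" "v \<in> verts S" "a = f u" "b = f v"
        using bij_betw_imp_surj_on[OF f] by (metis imageE)
      then have "{u, v} \<in> edges S" "y = f ` {u, v}" using e y ab by auto
      then show "y \<in> (`) f ` edges S" by blast
    qed
  qed
  ultimately show ?thesis by (metis card_image)
qed

text \<open>A rainbow colouring qualifies, so the \<open>LEAST\<close> in \<open>gen_ramsey\<close>
  ranges over a nonempty set.\<close>

lemma gen_ramsey_attained:
  assumes "finite (edges G)" "simple_graph H" "q \<le> card (edges H)"
  obtains c where "Hq_coloring G H q c" "c ` edges G \<subseteq> {..<gen_ramsey G H q}"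
proof -
  obtain c :: "'a set \<Rightarrow> nat" and k where c: "c ` edges G = {i. i < k}" "inj_on c (edges G)"
    using finite_imp_inj_to_nat_seg[OF assms(1)] by blast
  have "Hq_coloring G H q c"
    unfolding Hq_coloring_def
  proof (intro allI impI)
    fix S assume S: "is_subgraph S G \<and> graph_iso S H"
    then have "inj_on c (edges S)"
      using c(2) inj_on_subset unfolding is_subgraph_def by blast
    then show "q \<le> card (c ` edges S)"
      using S graph_iso_card_edges[of S H] assms by (simp add: card_image is_subgraph_def)
  qed
  moreover have "c ` edges G \<subseteq> {..<k}" using c(1) by auto
  ultimately have "\<exists>k c. Hq_coloring G H q c \<and> c ` edges G \<subseteq> {..<k}" by blast
  from LeastI_ex[OF this] that show thesis unfolding gen_ramsey_def by blast
qed

abbreviation left_side :: "nat \<Rightarrow> (nat + nat) set" where "left_side n \<equiv> Inl ` {..<n}"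
abbreviation right_side :: "nat \<Rightarrow> (nat + nat) set" where "right_side n \<equiv> Inr ` {..<n}"

lemma edges_complete_bipartite:
  "edges (complete_bipartite m n) = cross (left_side m) (right_side n)"
  unfolding complete_bipartite_def cross_def by auto

text \<open>Extend the vertices of \<open>F\<close> to a copy of K_{p,p}. Each of its edges outside
  \<open>F\<close> brings at most one further colour, so the lower bound on all colours turns into
  one on the colours of \<open>F\<close>.\<close>

lemma coloring_saving_le:
  assumes col: "Hq_coloring (complete_bipartite n n) (complete_bipartite p p) (p\<^sup>2 - S + 2) c"
    and "p \<le> n" "S \<le> p\<^sup>2"
    and F: "F \<subseteq> cross (left_side n) (right_side n)"
    and cards: "card (\<Union>F \<inter> left_side n) \<le> p" "card (\<Union>F \<inter> right_side n) \<le> p"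
  shows "card F + 2 \<le> card (c ` F) + S"
proof -
  have sides: "card (left_side n) = n" "card (right_side n) = n" by (simp_all add: card_image)
  obtain A where A: "\<Union>F \<inter> left_side n \<subseteq> A" "A \<subseteq> left_side n" "card A = p"
    using exists_subset_between[OF cards(1), of "left_side n"] sides \<open>p \<le> n\<close> by auto
  obtain B where B: "\<Union>F \<inter> right_side n \<subseteq> B" "B \<subseteq> right_side n" "card B = p"
    using exists_subset_between[OF cards(2), of "right_side n"] sides \<open>p \<le> n\<close> by auto
  have fin: "finite A" "finite B" using A(2) B(2) finite_subset by blast+
  have dAB: "A \<inter> B = {}" using A(2) B(2) by auto
  let ?S = "(A \<union> B, cross A B)"
  have sub: "is_subgraph ?S (complete_bipartite n n)"
  proof -
    have "card e = 2 \<and> e \<subseteq> A \<union> B" if e: "e \<in> cross A B" for e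
    proof -
      obtain u v where "e = {u, v}" "u \<in> A" "v \<in> B" using e unfolding cross_def by blast
      moreover have "u \<noteq> v" using \<open>u \<in> A\<close> \<open>v \<in> B\<close> dAB by blast
      ultimately show ?thesis by simp
    qed
    moreover have "cross A B \<subseteq> cross (left_side n) (right_side n)"
      using A(2) B(2) by (rule cross_mono)
    moreover have "A \<union> B \<subseteq> verts (complete_bipartite n n)"
      using A(2) B(2) unfolding complete_bipartite_def by auto
    ultimately show ?thesis
      using fin unfolding is_subgraph_def simple_graph_def edges_complete_bipartite by auto
  qed
  obtain g where g: "bij_betw g A {..<p}"
    using ex_bij_betw_finite_nat[OF fin(1)] A(3) by (auto simp: atLeast0LessThan)
  obtain h where h: "bij_betw h B {..<p}"
    using ex_bij_betw_finite_nat[OF fin(2)] B(3) by (auto simp: atLeast0LessThan)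
  define f where "f = (\<lambda>v. if v \<in> A then Inl (g v) else Inr (h v))"
  have fA: "f v \<in> left_side p" if "v \<in> A" for v
    using that g by (auto simp: f_def bij_betw_def)
  have fB: "f v \<in> right_side p" if "v \<in> B" for v
    using that h dAB by (auto simp: f_def bij_betw_def)
  have "graph_iso ?S (complete_bipartite p p)"
    unfolding graph_iso_def
  proof (intro exI[of _ f] conjI ballI)
    have "bij_betw f A (left_side p)"
      using g by (auto simp: f_def bij_betw_def inj_on_def image_iff)
    moreover have "bij_betw f B (right_side p)"
    proof -
      have "bij_betw (Inr \<circ> h) B (right_side p)"
        by (rule bij_betw_trans[OF h]) (simp add: bij_betw_def)
      moreover have "bij_betw f B (right_side p) = bij_betw (Inr \<circ> h) B (right_side p)"
        by (rule bij_betw_cong) (use dAB in \<open>auto simp: f_def\<close>)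
      ultimately show ?thesis by simp
    qed
    ultimately have "bij_betw f (A \<union> B) (left_side p \<union> right_side p)"
      by (rule bij_betw_combine) auto
    then show "bij_betw f (verts ?S) (verts (complete_bipartite p p))"
      by (simp add: complete_bipartite_def)
    fix u v assume "u \<in> verts ?S" "v \<in> verts ?S"
    then have "u \<in> A \<or> u \<in> B" "v \<in> A \<or> v \<in> B" by auto
    moreover have "x \<in> left_side p \<Longrightarrow> x \<notin> right_side p" for x by auto
    ultimately show "({u, v} \<in> edges ?S) = ({f u, f v} \<in> edges (complete_bipartite p p))"
      unfolding edges_complete_bipartite snd_conv cross_doubleton_iff
      using fA fB dAB by blast
  qed
  with sub col have q: "p\<^sup>2 - S + 2 \<le> card (c ` cross A B)"
    unfolding Hq_coloring_def by fastforce
  have FE: "F \<subseteq> cross A B"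
  proof
    fix e assume e: "e \<in> F"
    then obtain u v where uv: "e = {u, v}" "u \<in> left_side n" "v \<in> right_side n"
      using F unfolding cross_def by blast
    then have "u \<in> A" "v \<in> B" using e A(1) B(1) by blast+
    then show "e \<in> cross A B" using uv by (auto intro: crossI)
  qed
  have finAB: "finite (cross A B)" using fin by (rule finite_cross)
  have "cross A B = (\<lambda>(u, v). {u, v}) ` (A \<times> B)" unfolding cross_def by auto
  then have "card (cross A B) \<le> p\<^sup>2"
    using card_image_le[of "A \<times> B" "\<lambda>(u, v). {u, v}"] fin A(3) B(3)
    by (simp add: card_cartesian_product power2_eq_square)
  have "c ` cross A B \<subseteq> c ` F \<union> c ` (cross A B - F)" by blast
  then have "card (c ` cross A B) \<le> card (c ` F \<union> c ` (cross A B - F))"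
    using finAB finite_subset[OF FE finAB] by (intro card_mono) auto
  also have "\<dots> \<le> card (c ` F) + card (c ` (cross A B - F))" by (rule card_Un_le)
  also have "\<dots> \<le> card (c ` F) + card (cross A B - F)"
    using finAB by (intro add_left_mono card_image_le) auto
  finally have "card (c ` cross A B) \<le> card (c ` F) + card (cross A B - F)" .
  moreover have "card (cross A B - F) = card (cross A B) - card F" "card F \<le> card (cross A B)"
    using finAB FE finite_subset[OF FE finAB] by (auto intro: card_Diff_subset card_mono)
  ultimately show ?thesis using q \<open>card (cross A B) \<le> p\<^sup>2\<close> \<open>S \<le> p\<^sup>2\<close> by linarith
qed

theorem theorem1p8:
  fixes r s t p :: nat
  assumes "t \<ge> 2" and "r \<ge> 3" and "s \<ge> 2 * r - 1" and "odd s"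
    and "p = r * ((s - 1) * t div 2 + 1)"
  shows "(\<lambda>n::nat. real (gen_ramsey (complete_bipartite n n) (complete_bipartite p p)
             (p\<^sup>2 - (r - 1) * s * t + 2)))
         \<in> \<Omega>(\<lambda>n. real n powr (real r / (real r - 1) * (1 - 1 / real s)))"
proof -
  obtain h where s: "s = 2 * h + 1" using \<open>odd s\<close> by (elim oddE)
  have rh: "r \<le> h + 1" using assms(2,3) s by linarith
  have p: "p = r * (h * t + 1)" using assms(5) s by simp
  define S where "S = (r - 1) * s * t"
  define \<beta> where "\<beta> = 2 * p * r * p ^ r"
  define \<kappa> where "\<kappa> = real ((8 * p * r) ^ r * 12 * \<beta>)"
  \<comment> \<open>From \<open>\<epsilon> <= 1\<close> follows
    \<open>\<epsilon> ^ (r - 1) <= \<epsilon>\<close>, so \<open>\<kappa> * \<epsilon> < 1\<close>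
    suffices for \<open>few\<close>.\<close>
  define \<epsilon> where "\<epsilon> = 1 / (\<kappa> + 1)"
  define \<gamma> where "\<gamma> = real r / (real r - 1) * (1 - 1 / real s)"
  have \<kappa>: "\<kappa> \<ge> 0" by (simp add: \<kappa>_def)
  have \<epsilon>: "0 < \<epsilon>" "\<epsilon> \<le> 1" "\<kappa> * \<epsilon> < 1" using \<kappa> by (auto simp: \<epsilon>_def field_simps)
  note range = parameter_range[OF assms, folded S_def]
  have "\<epsilon> * real n powr \<gamma>
      \<le> real (gen_ramsey (complete_bipartite n n) (complete_bipartite p p) (p\<^sup>2 - S + 2))"
    if n: "n \<ge> p" "n \<ge> 1" for n
  proof (rule ccontr)
    define C where "C = gen_ramsey (complete_bipartite n n) (complete_bipartite p p) (p\<^sup>2 - S + 2)"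
    \<comment> \<open>This complements \<open>\<gamma> * (r - 1) = r - r / s\<close>, so that
      \<open>d * n powr (\<gamma> * (r - 1))\<close> equals \<open>n ^ r\<close>.\<close>
    define d where "d = real n powr (real r / real s)"
    assume "\<not> ?thesis"
    then have C: "real C \<le> \<epsilon> * real n powr \<gamma>" by (simp add: C_def)
    have "finite (edges (complete_bipartite n n))"
      unfolding edges_complete_bipartite by (rule finite_cross) auto
    moreover have "p\<^sup>2 - S + 2 \<le> card (edges (complete_bipartite p p))"
      using range(2) by (simp add: card_edges_complete_bipartite power2_eq_square)
    ultimately obtain c
      where col: "Hq_coloring (complete_bipartite n n) (complete_bipartite p p) (p\<^sup>2 - S + 2) c"
        and cC: "c ` edges (complete_bipartite n n) \<subseteq> {..<C}"
      using gen_ramsey_attained simple_graph_complete_bipartite unfolding C_def by metis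
    have "real C ^ (r - 1) \<le> (\<epsilon> * real n powr \<gamma>) ^ (r - 1)" by (rule power_mono[OF C]) simp
    also have "\<dots> = \<epsilon> ^ (r - 1) * (real n powr \<gamma>) ^ (r - 1)" by (rule power_mult_distrib)
    also have "\<dots> \<le> \<epsilon> * (real n powr \<gamma>) ^ (r - 1)"
      using \<epsilon> assms(2) power_decreasing[of 1 "r - 1" \<epsilon>] by (intro mult_right_mono) auto
    also have "(real n powr \<gamma>) ^ (r - 1) = real n powr (\<gamma> * real (r - 1))"
      using n by (simp add: powr_powr flip: powr_realpow)
    also have "\<gamma> * real (r - 1) = real r - real r / real s"
    proof -
      have "real r - 1 \<noteq> 0" using assms(2) by simp
      then have "\<gamma> * (real r - 1) = real r * (1 - 1 / real s)" by (simp add: \<gamma>_def)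
      then show ?thesis using assms(2) by (simp add: right_diff_distrib)
    qed
    finally have Cr: "real C ^ (r - 1) \<le> \<epsilon> * real n powr (real r - real r / real s)" .
    have "\<kappa> * d * real C ^ (r - 1)
        \<le> \<kappa> * d * (\<epsilon> * real n powr (real r - real r / real s))"
      using Cr \<kappa> by (intro mult_left_mono) (auto simp: d_def)
    also have "\<dots> = \<kappa> * \<epsilon> * (d * real n powr (real r - real r / real s))" by simp
    also have "d * real n powr (real r - real r / real s) = real n ^ r"
    proof -
      have "real r / real s + (real r - real r / real s) = real r" by simp
      then show ?thesis using n by (simp add: d_def powr_realpow flip: powr_add)
    qed
    also have "\<kappa> * \<epsilon> * real n ^ r < 1 * real n ^ r"
      using \<epsilon>(3) n by (intro mult_strict_right_mono) auto
    finally have few: "\<kappa> * d * real C ^ (r - 1) < real n ^ r" by simp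
    have "few_colors (left_side n) (right_side n) c n C p S r s t h \<beta> d"
    proof
      show "c ` cross (left_side n) (right_side n) \<subseteq> {..<C}"
        using cC by (simp add: edges_complete_bipartite)
      show "card F + 2 \<le> card (c ` F) + S"
        if "F \<subseteq> cross (left_side n) (right_side n)"
          "card (\<Union>F \<inter> left_side n) \<le> p" "card (\<Union>F \<inter> right_side n) \<le> p" for F
        by (rule coloring_saving_le[OF col n(1) range(1) that])
      show "1 \<le> d" using n by (simp add: d_def ge_one_powr_ge_zero)
      show "d ^ s = real n ^ r"
      proof -
        have "s \<noteq> 0" using s by simp
        then show ?thesis using n by (simp add: d_def powr_powr flip: powr_realpow)
      qed
      show "real ((8 * p * r) ^ r * 12 * \<beta>) * d * real C ^ (r - 1) < real n ^ r"
        using few by (simp only: \<kappa>_def)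
    qed (use assms(1,2) rh s p in \<open>auto simp: S_def \<beta>_def card_image\<close>)
    then show False by (rule few_colors.contradiction)
  qed
  then have "eventually (\<lambda>n. \<epsilon> * norm (real n powr \<gamma>)
      \<le> norm (real (gen_ramsey (complete_bipartite n n) (complete_bipartite p p) (p\<^sup>2 - S + 2)))) at_top"
    by (intro eventually_sequentiallyI[of "max p 1"]) simp
  from landau_omega.bigI[OF \<epsilon>(1) this] show ?thesis unfolding S_def \<gamma>_def .
qed

end
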